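(* Let $c>0$. There exist constants $C>0$ and $q_0$, depending only on $c$, such that for every prime power $q\ge q_0$ with $q\equiv 3\pmod 4$ and every set $\mathcal{E}\subseteq\mathbb{F}_q^2$ with $|\mathcal{E}|\ge c\,q$, we have \[\left\vert E_{+}^2(\mathcal{E})-\frac{|\mathcal{E}|^8}{q}\right\vert \le C\, q^3|\mathcal{E}|^{9/2}.\]
   Context: $\mathbb{F}_q$ is the finite field of order $q$. For $\mathbf{x},\mathbf{y}\in\mathbb{F}_q^2$ put $||\mathbf{x}-\mathbf{y}||=(x_1-y_1)^2+(x_2-y_2)^2\in\mathbb{F}_q$. For $\mathcal{E}\subseteq\mathbb{F}_q^2$, $E_{+}^2(\mathcal{E})$ denotes the number of tuples $(\mathbf{x}_i,\mathbf{y}_i)_{i=1}^{4}\in(\mathcal{E}\times\mathcal{E})^{4}$ such that \[||\mathbf{x}_1-\mathbf{y}_1||+||\mathbf{x}_2-\mathbf{y}_2||=||\mathbf{x}_{3}-\mathbf{y}_{3}||+||\mathbf{x}_{4}-\mathbf{y}_{4}||\quad\text{in }\mathbb{F}_q.\] *)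

theory Defs
  imports Complex_Main "HOL-Algebra.Ring" "HOL-Number_Theory.Cong" "HOL-Number_Theory.Prime_Powers"
begin

(* The finite field is a record R with an explicit carrier, not a type of class field, so that
   a statement can quantify over all finite fields after its constants have been chosen.  The
   element type 'a of R is arbitrary: already 'a = nat contains an isomorphic copy of every
   finite field, so constants chosen for that instance are uniform over all of them. *)

definition sq_dist :: "('a, 'm) ring_scheme \<Rightarrow> 'a \<times> 'a \<Rightarrow> 'a \<times> 'a \<Rightarrow> 'a" where
  "sq_dist R x y =
     (fst x \<ominus>\<^bsub>R\<^esub> fst y) [^]\<^bsub>R\<^esub> (2::nat) \<oplus>\<^bsub>R\<^esub> (snd x \<ominus>\<^bsub>R\<^esub> snd y) [^]\<^bsub>R\<^esub> (2::nat)"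

definition dist_energy :: "('a, 'm) ring_scheme \<Rightarrow> ('a \<times> 'a) set \<Rightarrow> nat" where
  "dist_energy R E = card
     {((x1, y1), (x2, y2), (x3, y3), (x4, y4)) | x1 y1 x2 y2 x3 y3 x4 y4.
        {x1, y1, x2, y2, x3, y3, x4, y4} \<subseteq> E \<and>
        sq_dist R x1 y1 \<oplus>\<^bsub>R\<^esub> sq_dist R x2 y2 = sq_dist R x3 y3 \<oplus>\<^bsub>R\<^esub> sq_dist R x4 y4}"

end

(*
  Let n = |E|, let chi be a nontrivial additive character of the field, and put
  nu(s) = sum over x, y in E of chi(s |x - y|).  Orthogonality of characters gives
  q * energy = sum_s |nu(s)|^4; the term s = 0 is n^8, so the nonzero s have to be bounded.

  Parseval for the kernel chi(s |x - y|) and Cauchy-Schwarz give |nu(s)| <= q n, which leaves the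
  second moment of nu.  With F(xi) = sum over x in E of chi(xi . x), completing the square shows
  that q |nu(s)| is the absolute value of the sum over xi of |F(xi)|^2 chi(r |xi|), where
  r = -1/(4s).  By Parseval over r the second moment is at most (1/q) sum_t S(t)^2, where S(t) is
  the sum of |F|^2 over the circle of radius t.  Since sum_t S(t) = q^2 n, it remains to bound each
  S(t), i.e. to prove an L^2-L^4 restriction estimate for circles.  That follows from Hoelder and
  from the fact that, as -1 is not a square, a nonzero vector is a sum of two points of a circle in
  essentially one way; the result is S(t) <= q (3 n^3)^(1/2).
*)
theory Submission
  imports Defs "HOL-Analysis.Convex" "HOL-Algebra.Multiplicative_Group"
begin

section \<open>Parseval identities for orthogonal families\<close>

text \<open>The squared modulus becomes a double sum over \<open>A\<close>, and the sum over
  \<open>G\<close> is carried out first. Orthogonality is asked only between different fibres of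
  \<open>f\<close>, because in the applications many indices share the same phase. The identity is
  complex since its right side is not visibly real.\<close>

lemma parseval:
  fixes w :: "'i \<Rightarrow> complex"
  assumes orth: "\<And>a b. a \<in> A \<Longrightarrow> b \<in> A \<Longrightarrow>
      (\<Sum>g\<in>G. e g a * cnj (e g b)) = (if f a = f b then of_real Q else 0)"
  shows "of_real (\<Sum>g\<in>G. (cmod (\<Sum>a\<in>A. w a * e g a))\<^sup>2)
    = of_real Q * (\<Sum>a\<in>A. \<Sum>b\<in>A. if f a = f b then w a * cnj (w b) else 0)"
proof -
  have "of_real (\<Sum>g\<in>G. (cmod (\<Sum>a\<in>A. w a * e g a))\<^sup>2)
    = (\<Sum>g\<in>G. \<Sum>a\<in>A. \<Sum>b\<in>A. (w a * cnj (w b)) * (e g a * cnj (e g b)))"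
    unfolding of_real_sum complex_norm_square
    by (simp add: sum_product mult_ac)
  also have "\<dots> = (\<Sum>a\<in>A. \<Sum>b\<in>A. \<Sum>g\<in>G. (w a * cnj (w b)) * (e g a * cnj (e g b)))"
    by (subst sum.swap, rule sum.cong[OF refl], rule sum.swap)
  also have "\<dots> = (\<Sum>a\<in>A. \<Sum>b\<in>A. (w a * cnj (w b)) * (if f a = f b then of_real Q else 0))"
    unfolding sum_distrib_left[symmetric] by (intro sum.cong refl arg_cong2[where f="(*)"] orth)
  also have "\<dots> = of_real Q * (\<Sum>a\<in>A. \<Sum>b\<in>A. if f a = f b then w a * cnj (w b) else 0)"
    unfolding sum_distrib_left by (intro sum.cong refl) auto
  finally show ?thesis .
qed

lemma parseval_inj:
  fixes w :: "'i \<Rightarrow> complex"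
  assumes "finite A"
    and orth: "\<And>a b. a \<in> A \<Longrightarrow> b \<in> A \<Longrightarrow>
      (\<Sum>g\<in>G. e g a * cnj (e g b)) = (if a = b then of_real Q else 0)"
  shows "(\<Sum>g\<in>G. (cmod (\<Sum>a\<in>A. w a * e g a))\<^sup>2) = Q * (\<Sum>a\<in>A. (cmod (w a))\<^sup>2)"
proof -
  have "complex_of_real (\<Sum>g\<in>G. (cmod (\<Sum>a\<in>A. w a * e g a))\<^sup>2) = of_real Q * (\<Sum>a\<in>A. w a * cnj (w a))"
    using parseval[of A e G "\<lambda>a. a" Q w, OF orth] assms(1) by simp
  also have "\<dots> = of_real (Q * (\<Sum>a\<in>A. (cmod (w a))\<^sup>2))"
    unfolding of_real_mult of_real_sum complex_norm_square ..
  finally show ?thesis unfolding of_real_eq_iff .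
qed

text \<open>The pairs with \<open>f a = f b\<close> are grouped by their common value t, and each
  group is the squared modulus of one fibre sum. With f the squared norm the fibres are
  circles.\<close>

lemma parseval_fibres:
  fixes w :: "'i \<Rightarrow> complex"
  assumes A: "finite A" and T: "finite T" "f ` A \<subseteq> T"
    and orth: "\<And>a b. a \<in> A \<Longrightarrow> b \<in> A \<Longrightarrow>
      (\<Sum>g\<in>G. e g a * cnj (e g b)) = (if f a = f b then of_real Q else 0)"
  shows "(\<Sum>g\<in>G. (cmod (\<Sum>a\<in>A. w a * e g a))\<^sup>2)
    = Q * (\<Sum>t\<in>T. (cmod (\<Sum>a | a \<in> A \<and> f a = t. w a))\<^sup>2)"
proof -
  have "(\<Sum>a\<in>A. \<Sum>b\<in>A. if f a = f b then w a * cnj (w b) else 0)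
      = (\<Sum>a\<in>A. w a * cnj (\<Sum>b | b \<in> A \<and> f b = f a. w b))"
    unfolding cnj_sum sum_distrib_left sum.inter_filter[OF A] by (intro sum.cong refl) auto
  also have "\<dots> = (\<Sum>t\<in>T. \<Sum>a | a \<in> A \<and> f a = t. w a * cnj (\<Sum>b | b \<in> A \<and> f b = f a. w b))"
    using A T by (intro sum.group[symmetric])
  also have "\<dots> = (\<Sum>t\<in>T. of_real ((cmod (\<Sum>a | a \<in> A \<and> f a = t. w a))\<^sup>2))"
    by (intro sum.cong refl) (auto simp: complex_norm_square sum_distrib_right simp del: of_real_power
        intro!: sum.cong)
  finally have "complex_of_real (\<Sum>g\<in>G. (cmod (\<Sum>a\<in>A. w a * e g a))\<^sup>2)
      = of_real (Q * (\<Sum>t\<in>T. (cmod (\<Sum>a | a \<in> A \<and> f a = t. w a))\<^sup>2))"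
    using parseval[of A e G f Q w, OF orth] by simp
  then show ?thesis unfolding of_real_eq_iff .
qed

text \<open>With unit weights the double sum counts coincidences of \<open>f\<close>; this is how a
  moment of a character sum becomes an energy.\<close>

lemma parseval_card:
  assumes A: "finite A"
    and orth: "\<And>a b. a \<in> A \<Longrightarrow> b \<in> A \<Longrightarrow>
      (\<Sum>g\<in>G. e g a * cnj (e g b)) = (if f a = f b then of_real Q else 0)"
  shows "(\<Sum>g\<in>G. (cmod (\<Sum>a\<in>A. e g a))\<^sup>2) = Q * real (card {p \<in> A \<times> A. f (fst p) = f (snd p)})"
proof -
  have "complex_of_nat (card {p \<in> A \<times> A. f (fst p) = f (snd p)})
      = (\<Sum>p \<in> {p \<in> A \<times> A. f (fst p) = f (snd p)}. 1)"
    by simp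
  also have "\<dots> = (\<Sum>p \<in> A \<times> A. if f (fst p) = f (snd p) then 1 else 0)"
    using A by (intro sum.inter_filter) simp
  also have "\<dots> = (\<Sum>a\<in>A. \<Sum>b\<in>A. if f a = f b then 1 else 0)"
    unfolding sum.cartesian_product by (intro sum.cong refl) auto
  finally have count: "(\<Sum>a\<in>A. \<Sum>b\<in>A. if f a = f b then 1 else 0)
      = complex_of_nat (card {p \<in> A \<times> A. f (fst p) = f (snd p)})" ..
  have "complex_of_real (\<Sum>g\<in>G. (cmod (\<Sum>a\<in>A. 1 * e g a))\<^sup>2)
      = of_real Q * (\<Sum>a\<in>A. \<Sum>b\<in>A. if f a = f b then 1 * cnj 1 else 0)"
    using orth by (rule parseval)
  also have "\<dots> = of_real (Q * real (card {p \<in> A \<times> A. f (fst p) = f (snd p)}))"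
    by (simp only: complex_cnj_one mult_1 count of_real_mult of_real_of_nat_eq)
  finally show ?thesis unfolding of_real_eq_iff mult_1 .
qed

text \<open>The triangle inequality passes to the moduli of the weights, so that the remaining sum
  has nonnegative terms and can be enlarged freely.\<close>

lemma parseval_le:
  fixes w :: "'i \<Rightarrow> complex"
  assumes "Q \<ge> 0"
    and orth: "\<And>a b. a \<in> A \<Longrightarrow> b \<in> A \<Longrightarrow>
      (\<Sum>g\<in>G. e g a * cnj (e g b)) = (if f a = f b then of_real Q else 0)"
  shows "(\<Sum>g\<in>G. (cmod (\<Sum>a\<in>A. w a * e g a))\<^sup>2)
    \<le> Q * (\<Sum>a\<in>A. \<Sum>b\<in>A. if f a = f b then cmod (w a) * cmod (w b) else 0)"
proof -
  let ?L = "\<Sum>g\<in>G. (cmod (\<Sum>a\<in>A. w a * e g a))\<^sup>2"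
  have "?L = cmod (of_real ?L)" unfolding norm_of_real by (simp add: sum_nonneg)
  also have "\<dots> = Q * cmod (\<Sum>a\<in>A. \<Sum>b\<in>A. if f a = f b then w a * cnj (w b) else 0)"
    using parseval[of A e G f Q w, OF orth] assms(1) by (simp add: norm_mult)
  also have "\<dots> \<le> Q * (\<Sum>a\<in>A. \<Sum>b\<in>A. if f a = f b then cmod (w a) * cmod (w b) else 0)"
    using assms(1) by (intro mult_left_mono sum_norm_le) (auto simp: norm_mult)
  finally show ?thesis .
qed

text \<open>Cauchy-Schwarz twice, that is, Hoelder with exponents 4 and 4/3.\<close>

lemma sum_power4_le:
  fixes h :: "'i \<Rightarrow> real"
  shows "(\<Sum>x\<in>E. h x) ^ 4 \<le> real (card E) ^ 3 * (\<Sum>x\<in>E. h x ^ 4)"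
proof -
  have "(\<Sum>x\<in>E. h x) ^ 4 = ((\<Sum>x\<in>E. h x)\<^sup>2)\<^sup>2" by simp
  also have "\<dots> \<le> ((\<Sum>x\<in>E. (h x)\<^sup>2) * real (card E))\<^sup>2"
    by (intro power_mono sum_squared_le_sum_of_squares) simp
  also have "\<dots> = (\<Sum>x\<in>E. (h x)\<^sup>2)\<^sup>2 * (real (card E))\<^sup>2" by (simp add: power_mult_distrib)
  also have "\<dots> \<le> ((\<Sum>x\<in>E. ((h x)\<^sup>2)\<^sup>2) * real (card E)) * (real (card E))\<^sup>2"
    by (intro mult_right_mono sum_squared_le_sum_of_squares) simp
  also have "\<dots> = real (card E) ^ 3 * (\<Sum>x\<in>E. h x ^ 4)" by (simp add: power2_eq_square power3_eq_cube power4_eq_xxxx mult_ac)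
  finally show ?thesis .
qed

section \<open>Characters of finite abelian groups\<close>

text \<open>For a maximal proper subgroup \<open>H\<close> and \<open>x \<notin> H\<close> the quotient by \<open>H\<close> is cyclic, generated by \<open>x\<close>;
  the character is the pullback of a faithful character of this quotient.\<close>
lemma (in comm_group) nontrivial_character_exists:
  assumes fin: "finite (carrier G)" and nontriv: "carrier G \<noteq> {\<one>}"
  obtains \<chi> :: "'a \<Rightarrow> complex" and x where
    "\<And>a b. a \<in> carrier G \<Longrightarrow> b \<in> carrier G \<Longrightarrow> \<chi> (a \<otimes> b) = \<chi> a * \<chi> b"
    "\<And>a. cmod (\<chi> a) = 1" "x \<in> carrier G" "\<chi> x \<noteq> 1"
proof -
  define S where "S = {H. subgroup H G \<and> H \<noteq> carrier G}"
  have "finite S" using fin by (rule_tac finite_subset[of _ "Pow (carrier G)"]) (auto simp: S_def dest: subgroup.subset)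
  moreover have "{\<one>} \<in> S" using nontriv triv_subgroup by (auto simp: S_def)
  ultimately obtain H where "H \<in> S" and max: "\<And>K. K \<in> S \<Longrightarrow> H \<subseteq> K \<Longrightarrow> H = K"
    using finite_has_maximal[of S] by auto
  then have sub: "subgroup H G" and ne: "H \<noteq> carrier G" by (auto simp: S_def)
  have HG: "h \<in> carrier G" if "h \<in> H" for h using that subgroup.subset[OF sub] by auto
  obtain x where x: "x \<in> carrier G" "x \<notin> H" using ne subgroup.subset[OF sub] by auto
  \<comment> \<open>The subgroup generated by \<open>H\<close> and \<open>x\<close>. It is strictly
    larger than \<open>H\<close>, so maximality makes it the whole group: every element is some h
    x^k.\<close>
  define K where "K = {h \<otimes> x [^] k | h k. h \<in> H \<and> (k::int) \<in> UNIV}"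
  have "subgroup K G"
  proof (rule subgroupI)
    show "K \<subseteq> carrier G" using x HG by (auto simp: K_def)
    show "K \<noteq> {}" using subgroup.one_closed[OF sub] by (auto simp: K_def)
    fix a assume "a \<in> K"
    then obtain h k where a: "a = h \<otimes> x [^] (k::int)" "h \<in> H" by (auto simp: K_def)
    have "inv a = inv h \<otimes> x [^] (-k)" using a x HG by (simp add: inv_mult int_pow_neg)
    then show "inv a \<in> K" using subgroup.m_inv_closed[OF sub a(2)] by (auto simp: K_def)
    fix b assume "b \<in> K"
    then obtain h' k' where b: "b = h' \<otimes> x [^] (k'::int)" "h' \<in> H" by (auto simp: K_def)
    have "a \<otimes> b = (h \<otimes> h') \<otimes> x [^] (k + k')"
      using a b x HG by (simp add: int_pow_mult m_ac)
    then show "a \<otimes> b \<in> K" using subgroup.m_closed[OF sub a(2) b(2)] by (auto simp: K_def)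
  qed
  moreover have "H \<subseteq> K"
  proof
    fix h assume "h \<in> H"
    then have "h = h \<otimes> x [^] (0::int)" using HG by simp
    then show "h \<in> K" using \<open>h \<in> H\<close> unfolding K_def by blast
  qed
  moreover have "x = \<one> \<otimes> x [^] (1::int)" using x by simp
  then have "x \<in> K" using subgroup.one_closed[OF sub] unfolding K_def by blast
  ultimately have K: "K = carrier G" using max[of K] x by (auto simp: S_def)
  \<comment> \<open>The order of \<open>x\<close> modulo \<open>H\<close>; the order of the group
    shows that such an exponent exists.\<close>
  define m where "m = (LEAST m. 0 < m \<and> x [^] (m::nat) \<in> H)"
  have "0 < order G \<and> x [^] order G \<in> H"
    using fin x pow_order_eq_1[of x] subgroup.one_closed[OF sub] by (auto simp: order_gt_0_iff_finite)
  then have m: "0 < m" "x [^] m \<in> H"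
    using LeastI[of "\<lambda>m. 0 < m \<and> x [^] (m::nat) \<in> H"] by (auto simp: m_def)
  have m_min: "\<not> (0 < r \<and> x [^] r \<in> H)" if "r < m" for r :: nat
    using not_less_Least[of r "\<lambda>m. 0 < m \<and> x [^] (m::nat) \<in> H"] that unfolding m_def by blast
  \<comment> \<open>Division with remainder: \<open>x\<close> to the power k mod m lies in
    \<open>H\<close>, so minimality of \<open>m\<close> forces the remainder to be 0.\<close>
  have dvd: "int m dvd k" if "x [^] k \<in> H" for k :: int
  proof -
    define r where "r = nat (k mod int m)"
    have r: "int r = k mod int m" "r < m" using m by (auto simp: r_def nat_less_iff)
    have "x [^] int r = x [^] k \<otimes> inv ((x [^] int m) [^] (k div int m))"
    proof -
      have "x [^] k = x [^] (int m * (k div int m) + int r)" using r by simp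
      also have "\<dots> = (x [^] int m) [^] (k div int m) \<otimes> x [^] int r"
        using x by (simp only: int_pow_mult int_pow_pow)
      finally have "x [^] k = x [^] int r \<otimes> (x [^] int m) [^] (k div int m)"
        using x by (simp add: m_comm)
      then show ?thesis using x by (metis int_pow_closed inv_solve_right)
    qed
    moreover have "(x [^] int m) [^] (k div int m) \<in> H"
      using m int_pow_int[of G x m] subgroup_int_pow_closed[OF sub] by metis
    ultimately have "x [^] r \<in> H"
      using that subgroup.m_inv_closed[OF sub] subgroup.m_closed[OF sub] by (metis int_pow_int)
    then have "r = 0" using m_min[OF r(2)] by auto
    then show ?thesis using r by auto
  qed
  \<comment> \<open>The exponent is determined only modulo \<open>m\<close>, which
    \<open>cis\<close> does not see. Outside the carrier \<kappa> is arbitrary, but \<chi> still has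
    modulus one there.\<close>
  define \<kappa> where "\<kappa> a = (SOME k::int. \<exists>h\<in>H. a = h \<otimes> x [^] k)" for a
  define \<chi> where "\<chi> a = cis (2 * pi * (of_int (\<kappa> a) / of_nat m))" for a
  \<comment> \<open>Independence of the choice: two exponents of one element differ by some k with
    x^k in \<open>H\<close>, hence by a multiple of \<open>m\<close>.\<close>
  have \<chi>_eq: "\<chi> (h \<otimes> x [^] k) = cis (2 * pi * (of_int k / of_nat m))" if h: "h \<in> H" for h and k :: int
  proof -
    let ?k = "\<kappa> (h \<otimes> x [^] k)"
    have "\<exists>h'\<in>H. h \<otimes> x [^] k = h' \<otimes> x [^] ?k"
      unfolding \<kappa>_def by (rule someI_ex) (use h in blast)
    then obtain h' where h': "h' \<in> H" "h \<otimes> x [^] k = h' \<otimes> x [^] ?k" by auto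
    have "x [^] (?k - k) = inv h' \<otimes> h"
    proof -
      have "h = h' \<otimes> x [^] ?k \<otimes> inv (x [^] k)"
        using h' h HG x by (metis int_pow_closed inv_solve_right m_closed)
      also have "\<dots> = h' \<otimes> (x [^] ?k \<otimes> inv (x [^] k))" using x h'(1) HG by (simp add: m_assoc)
      also have "\<dots> = h' \<otimes> x [^] (?k - k)" using x by (simp only: int_pow_diff)
      finally show ?thesis using x h' h HG by (metis int_pow_closed inv_solve_left)
    qed
    then have "x [^] (?k - k) \<in> H"
      using h h' subgroup.m_inv_closed[OF sub] subgroup.m_closed[OF sub] by simp
    then obtain j where "?k - k = int m * j" using dvd by (auto elim: dvdE)
    then have "?k = k + int m * j" by simp
    then have "2 * pi * (of_int ?k / of_nat m) = 2 * pi * (of_int k / of_nat m) + 2 * pi * of_int j"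
      using m by (simp add: field_simps)
    then show ?thesis unfolding \<chi>_def by (simp flip: cis_mult)
  qed
  show ?thesis
  proof
    show "cmod (\<chi> a) = 1" for a by (simp add: \<chi>_def)
    show "x \<in> carrier G" by (fact x)
    fix a b assume "a \<in> carrier G" "b \<in> carrier G"
    then obtain h k h' k' where ab: "h \<in> H" "h' \<in> H" "a = h \<otimes> x [^] (k::int)" "b = h' \<otimes> x [^] (k'::int)"
      using K unfolding K_def by blast
    have "a \<otimes> b = (h \<otimes> h') \<otimes> x [^] (k + k')"
      using ab x HG by (simp add: int_pow_mult m_ac)
    then show "\<chi> (a \<otimes> b) = \<chi> a * \<chi> b"
      using ab subgroup.m_closed[OF sub, of h h'] by (simp add: \<chi>_eq cis_mult ring_distribs add_divide_distrib)
  next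
    \<comment> \<open>The value is the primitive \<open>m\<close>-th root of unity, which is 1 only
      for \<open>m\<close> = 1; then \<open>x\<close> itself would lie in \<open>H\<close>.\<close>
    show "\<chi> x \<noteq> 1"
    proof
      assume "\<chi> x = 1"
      moreover have "\<chi> x = cis (2 * pi * (1 / of_nat m))"
        using \<chi>_eq[of \<one> 1] subgroup.one_closed[OF sub] x by simp
      ultimately have "cos (2 * pi * (1 / of_nat m)) = 1" by (metis cis.sel(1) one_complex.sel(1))
      then obtain n :: int where "2 * pi * (1 / of_nat m) = of_int n * 2 * pi"
        using cos_one_2pi_int by auto
      then have "real_of_int (n * int m) = 1" using m by (simp add: field_simps)
      then have "n * int m = 1" by linarith
      then have "m = 1" using m by (simp add: zmult_eq_1_iff)
      then show False using m x by simp
    qed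
  qed
qed

section \<open>The plane over a field of order 3 modulo 4\<close>

definition dot :: "('a, 'm) ring_scheme \<Rightarrow> 'a \<times> 'a \<Rightarrow> 'a \<times> 'a \<Rightarrow> 'a" where
  "dot R x y = fst x \<otimes>\<^bsub>R\<^esub> fst y \<oplus>\<^bsub>R\<^esub> snd x \<otimes>\<^bsub>R\<^esub> snd y"

definition vadd :: "('a, 'm) ring_scheme \<Rightarrow> 'a \<times> 'a \<Rightarrow> 'a \<times> 'a \<Rightarrow> 'a \<times> 'a" where
  "vadd R x y = (fst x \<oplus>\<^bsub>R\<^esub> fst y, snd x \<oplus>\<^bsub>R\<^esub> snd y)"

definition vdiff :: "('a, 'm) ring_scheme \<Rightarrow> 'a \<times> 'a \<Rightarrow> 'a \<times> 'a \<Rightarrow> 'a \<times> 'a" where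
  "vdiff R x y = (fst x \<ominus>\<^bsub>R\<^esub> fst y, snd x \<ominus>\<^bsub>R\<^esub> snd y)"

definition vscale :: "('a, 'm) ring_scheme \<Rightarrow> 'a \<Rightarrow> 'a \<times> 'a \<Rightarrow> 'a \<times> 'a" where
  "vscale R c x = (c \<otimes>\<^bsub>R\<^esub> fst x, c \<otimes>\<^bsub>R\<^esub> snd x)"

locale field_3mod4 = field R for R (structure) +
  assumes finite_carrier [simp]: "finite (carrier R)"
    and card_3mod4: "card (carrier R) mod 4 = 3"
begin

abbreviation V where "V \<equiv> carrier R \<times> carrier R"

lemmas ring_expand = minus_eq l_distr r_distr l_minus r_minus minus_add m_ac a_ac

text \<open>Once \<open>ring_expand\<close> has nested a sum to the right, opposite summands may
  stand apart. These rules cancel them across one to three intermediate terms.\<close>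

lemma neg_cancel:
  shows "x \<in> carrier R \<Longrightarrow> y \<in> carrier R
      \<Longrightarrow> x \<oplus> (y \<oplus> \<ominus> x) = y"
    and "x \<in> carrier R \<Longrightarrow> y \<in> carrier R \<Longrightarrow> z \<in> carrier R
      \<Longrightarrow> x \<oplus> (y \<oplus> (\<ominus> x \<oplus> z)) = y \<oplus> z"
    and "x \<in> carrier R \<Longrightarrow> y \<in> carrier R \<Longrightarrow> z \<in> carrier R
      \<Longrightarrow> x \<oplus> (y \<oplus> (z \<oplus> \<ominus> x)) = y \<oplus> z"
    and "x \<in> carrier R \<Longrightarrow> y \<in> carrier R \<Longrightarrow> z \<in> carrier R \<Longrightarrow> w \<in> carrier R
      \<Longrightarrow> x \<oplus> (y \<oplus> (z \<oplus> (\<ominus> x \<oplus> w))) = y \<oplus> (z \<oplus> w)"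
    and "x \<in> carrier R \<Longrightarrow> y \<in> carrier R \<Longrightarrow> z \<in> carrier R \<Longrightarrow> w \<in> carrier R
      \<Longrightarrow> x \<oplus> (y \<oplus> (z \<oplus> (w \<oplus> \<ominus> x))) = y \<oplus> (z \<oplus> w)"
  by (simp_all add: a_lcomm[of x y] a_lcomm[of x z] a_lcomm[of x w] r_neg r_neg2)

lemmas ring_cancel = r_neg r_neg1 r_neg2 neg_cancel

section \<open>Odd characteristic and absence of isotropic vectors\<close>

lemma odd_order_carrier: "odd (card (carrier R))"
  using card_3mod4 by presburger

text \<open>The additive group has odd order, so an odd multiple of 1 vanishes. If 1 + 1 = 0, the
  even part vanishes as well and 1 = 0 remains.\<close>

lemma two_nonzero: "\<one> \<oplus> \<one> \<noteq> \<zero>"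
proof
  assume two: "\<one> \<oplus> \<one> = \<zero>"
  have "order (add_monoid R) = card (carrier R)" by (simp add: order_def)
  then have "add_pow R (card (carrier R)) \<one> = \<zero>"
    using add.pow_order_eq_1[of \<one>] by simp
  moreover obtain k where k: "card (carrier R) = 2 * k + 1"
    using odd_order_carrier by (auto elim: oddE)
  have "add_pow R (2 * k) \<one> = \<zero>"
  proof (induction k)
    case (Suc k)
    have "add_pow R (2 * Suc k) \<one> = add_pow R (2 * k) \<one> \<oplus> (\<one> \<oplus> \<one>)"
      by (simp add: a_assoc)
    then show ?case using Suc two by simp
  qed simp
  ultimately show False using k by simp
qed

text \<open>The multiplicative group has order q - 1 = 2 (2k + 1). A root i of -1 would satisfy
  i^(q-1) = (-1)^(2k+1) = -1, while Lagrange's theorem gives 1.\<close>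

lemma minus_one_nonsquare:
  assumes i: "i \<in> carrier R"
  shows "i \<otimes> i \<noteq> \<ominus> \<one>"
proof
  assume sq: "i \<otimes> i = \<ominus> \<one>"
  have "\<ominus> \<one> \<noteq> \<zero>"
    using minus_minus[OF one_closed] one_not_zero by (metis minus_zero)
  then have "i \<noteq> \<zero>" using sq by (metis l_null zero_closed)
  then have U: "i \<in> Units R" using i by (simp add: field_Units)
  have card_U: "card (Units R) = card (carrier R) - 1"
    by (simp add: field_Units)
  have "order (units_of R) = card (carrier R) - 1"
    using card_U by (simp add: order_def units_of_carrier)
  then have "i [^] (card (carrier R) - 1) = \<one>"
    using group.pow_order_eq_1[OF units_group, of i] U units_of_pow[of i] by (simp add: units_of_carrier units_of_one)
  moreover obtain k where k: "card (carrier R) - 1 = 2 * (2 * k + 1)"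
  proof -
    have "card (carrier R) = 4 * (card (carrier R) div 4) + 3" using card_3mod4 by presburger
    then show ?thesis using that[of "card (carrier R) div 4"] by simp
  qed
  have "i [^] (2 * (2 * k + 1)) = \<ominus> \<one>"
  proof -
    have i2: "i [^] (2::nat) = \<ominus> \<one>" using sq i by (simp add: numeral_2_eq_2)
    have "i [^] (2 * (2 * k + 1)) = (\<ominus> \<one>) [^] (2 * k + 1)"
      by (simp only: nat_pow_pow[OF i, symmetric] i2)
    also have "\<dots> = ((\<ominus> \<one>) [^] (2::nat)) [^] k \<otimes> (\<ominus> \<one>)"
      by (subst nat_pow_pow) simp_all
    also have "(\<ominus> \<one>) [^] (2::nat) = \<one>" by (simp add: numeral_2_eq_2 l_minus r_minus)
    finally show ?thesis by simp
  qed
  ultimately have "\<one> = \<ominus> \<one>" using k by metis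
  then have "\<one> \<oplus> \<one> = \<one> \<oplus> \<ominus> \<one>" by (rule arg_cong)
  also have "\<dots> = \<zero>" by (simp add: r_neg)
  finally have "\<one> \<oplus> \<one> = \<zero>" .
  then show False using two_nonzero by simp
qed

text \<open>If b is nonzero, a/b is a square root of -1.\<close>

lemma dot_self_eq_zero:
  assumes v: "v \<in> V" and zero: "dot R v v = \<zero>"
  shows "v = (\<zero>, \<zero>)"
proof -
  obtain a b where v_eq: "v = (a, b)" and ab [simp]: "a \<in> carrier R" "b \<in> carrier R"
    using v by auto
  have sum: "a \<otimes> a \<oplus> b \<otimes> b = \<zero>" using zero by (simp add: v_eq dot_def)
  have "b = \<zero>"
  proof (rule ccontr)
    assume "b \<noteq> \<zero>"
    then have U: "b \<in> Units R" by (simp add: field_Units)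
    define i where "i = a \<otimes> inv b"
    have [simp]: "inv b \<in> carrier R" using U by simp
    have ib: "b \<otimes> inv b = \<one>" using U by simp
    have "i \<otimes> i \<oplus> \<one> = (a \<otimes> a \<oplus> b \<otimes> b) \<otimes> (inv b \<otimes> inv b)"
    proof -
      have "(a \<otimes> a \<oplus> b \<otimes> b) \<otimes> (inv b \<otimes> inv b) = i \<otimes> i \<oplus> (b \<otimes> inv b) \<otimes> (b \<otimes> inv b)"
        unfolding i_def by (simp add: ring_expand)
      then show ?thesis by (simp add: ib)
    qed
    then have "i \<otimes> i \<oplus> \<one> = \<zero>" using sum by simp
    then have "i \<otimes> i = \<ominus> \<one>" unfolding i_def by (simp add: sum_zero_eq_neg)
    then show False using minus_one_nonsquare[of i] by (simp add: i_def)
  qed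
  moreover have "a = \<zero>" using sum \<open>b = \<zero>\<close> integral[of a a] by simp
  ultimately show ?thesis by (simp add: v_eq)
qed

section \<open>Orthogonality in the plane\<close>

lemma dot_closed [simp]: "x \<in> V \<Longrightarrow> y \<in> V \<Longrightarrow> dot R x y \<in> carrier R"
  and vadd_closed [simp]: "x \<in> V \<Longrightarrow> y \<in> V \<Longrightarrow> vadd R x y \<in> V"
  and vdiff_closed [simp]: "x \<in> V \<Longrightarrow> y \<in> V \<Longrightarrow> vdiff R x y \<in> V"
  by (auto simp: dot_def vadd_def vdiff_def)

lemma dot_commute: "x \<in> V \<Longrightarrow> y \<in> V \<Longrightarrow> dot R x y = dot R y x"
  by (auto simp: dot_def m_comm)

lemma dot_vadd_right: "x \<in> V \<Longrightarrow> y \<in> V \<Longrightarrow> z \<in> V \<Longrightarrow> dot R x (vadd R y z) = dot R x y \<oplus> dot R x z"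
  by (auto simp: dot_def vadd_def ring_expand)

lemma dot_vdiff_right: "x \<in> V \<Longrightarrow> y \<in> V \<Longrightarrow> z \<in> V \<Longrightarrow> dot R x (vdiff R y z) = dot R x y \<ominus> dot R x z"
  by (auto simp: dot_def vdiff_def ring_expand)

lemma dot_vdiff_left: "x \<in> V \<Longrightarrow> y \<in> V \<Longrightarrow> z \<in> V \<Longrightarrow> dot R (vdiff R y z) x = dot R y x \<ominus> dot R z x"
  by (auto simp: dot_def vdiff_def ring_expand)

lemma vdiff_eq_zero:
  assumes "x \<in> V" "y \<in> V" "vdiff R x y = (\<zero>, \<zero>)"
  shows "x = y"
  using assms by (auto simp: vdiff_def prod_eq_iff)

text \<open>In dimension two, \<open>v\<close> and \<open>w\<close> are parallel because both are
  orthogonal to the nonzero \<open>u\<close>. Being also orthogonal to each other, they have norms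
  with product 0, and there are no isotropic vectors.\<close>

lemma orthogonal_triple:
  assumes "u \<in> V" "v \<in> V" "w \<in> V"
    and "u \<noteq> (\<zero>, \<zero>)"
    and "dot R w u = \<zero>" "dot R v u = \<zero>" "dot R w v = \<zero>"
  shows "v = (\<zero>, \<zero>) \<or> w = (\<zero>, \<zero>)"
proof -
  obtain u1 u2 v1 v2 w1 w2 where eqs: "u = (u1, u2)" "v = (v1, v2)" "w = (w1, w2)" 
    and [simp]: "u1 \<in> carrier R" "u2 \<in> carrier R" "v1 \<in> carrier R" "v2 \<in> carrier R" 
    "w1 \<in> carrier R" "w2 \<in> carrier R"
    using assms(1-3) by auto
  have wu: "w1 \<otimes> u1 \<oplus> w2 \<otimes> u2 = \<zero>" and vu: "v1 \<otimes> u1 \<oplus> v2 \<otimes> u2 = \<zero>"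
    and wv: "w1 \<otimes> v1 \<oplus> w2 \<otimes> v2 = \<zero>"
    using assms by (auto simp: eqs dot_def)
  \<comment> \<open>The determinant of \<open>w\<close> and \<open>v\<close>. As in Cramer's rule,
    the two orthogonality relations to \<open>u\<close> combine to u1 D = u2 D = 0.\<close>
  define D where "D = w1 \<otimes> v2 \<ominus> w2 \<otimes> v1"
  have [simp]: "D \<in> carrier R" by (simp add: D_def)
  have "u1 \<otimes> D \<oplus> w2 \<otimes> (v1 \<otimes> u1 \<oplus> v2 \<otimes> u2) = v2 \<otimes> (w1 \<otimes> u1 \<oplus> w2 \<otimes> u2)"
    unfolding D_def by (simp add: ring_expand ring_cancel)
  then have 1: "u1 \<otimes> D = \<zero>" by (simp add: wu vu)
  have "u2 \<otimes> D \<oplus> v1 \<otimes> (w1 \<otimes> u1 \<oplus> w2 \<otimes> u2) = w1 \<otimes> (v1 \<otimes> u1 \<oplus> v2 \<otimes> u2)"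
    unfolding D_def by (simp add: ring_expand ring_cancel)
  then have 2: "u2 \<otimes> D = \<zero>" by (simp add: wu vu)
  have D0: "w1 \<otimes> v2 = w2 \<otimes> v1" using 1 2 assms(4) integral[of u1 D] integral[of u2 D] 
    by (auto simp: eqs D_def)
  \<comment> \<open>Lagrange's identity \<open>(v \<cdot> v) (w \<cdot> w) = (w \<cdot> v)\<^sup>2 + D\<^sup>2\<close>, written without subtraction.\<close>
  have "dot R v v \<otimes> dot R w w = (w1 \<otimes> v1) \<otimes> (w1 \<otimes> v1) \<oplus> (w1 \<otimes> v2) \<otimes> (w1 \<otimes> v2)
     \<oplus> ((w2 \<otimes> v1) \<otimes> (w2 \<otimes> v1) \<oplus> (w2 \<otimes> v2) \<otimes> (w2 \<otimes> v2))"
    unfolding dot_def eqs fst_conv snd_conv by (simp add: ring_expand)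
  also have "\<dots> = (w1 \<otimes> v1) \<otimes> (w1 \<otimes> v1) \<oplus> (w1 \<otimes> v2) \<otimes> (w2 \<otimes> v1)
     \<oplus> ((w1 \<otimes> v2) \<otimes> (w2 \<otimes> v1) \<oplus> (w2 \<otimes> v2) \<otimes> (w2 \<otimes> v2))"
    by (simp only: D0)
  also have "\<dots> = (w1 \<otimes> v1 \<oplus> w2 \<otimes> v2) \<otimes> (w1 \<otimes> v1 \<oplus> w2 \<otimes> v2)"
    by (simp add: ring_expand)
  finally have "dot R v v \<otimes> dot R w w = \<zero>" by (simp add: wv)
  then have "dot R v v = \<zero> \<or> dot R w w = \<zero>" using integral assms by simp
  then show ?thesis using dot_self_eq_zero assms by blast
qed

section \<open>Sums of two points of a circle\<close>

lemma vadd_left_cancel: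
  assumes "vadd R x y = vadd R x z" "x \<in> V" "y \<in> V" "z \<in> V"
  shows "y = z"
  using assms by (auto simp: vadd_def prod_eq_iff)

lemma double_eq_zero:
  assumes "x \<in> carrier R" "x \<oplus> x = \<zero>"
  shows "x = \<zero>"
proof -
  have "(\<one> \<oplus> \<one>) \<otimes> x = x \<oplus> x" using assms(1) by (simp add: l_distr)
  then show ?thesis using assms two_nonzero integral[of "\<one> \<oplus> \<one>" x] by simp
qed

lemma dot_vdiff_vadd:
  assumes "x \<in> V" "y \<in> V" "dot R x x = dot R y y"
  shows "dot R (vdiff R x y) (vadd R x y) = \<zero>"
  using assms by (simp add: dot_vdiff_left dot_vadd_right dot_commute[of y x] ring_expand ring_cancel
     del: vadd_closed)

lemma minus_eq_minus:
  assumes eq: "p \<oplus> q = r \<oplus> s"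
    and [simp]: "p \<in> carrier R" "q \<in> carrier R" "r \<in> carrier R" "s \<in> carrier R"
  shows "r \<ominus> p = q \<ominus> s"
proof -
  have "r \<ominus> p = (r \<oplus> s) \<ominus> s \<ominus> p" by (simp add: ring_expand ring_cancel)
  also have "\<dots> = (p \<oplus> q) \<ominus> s \<ominus> p" by (simp only: eq)
  also have "\<dots> = q \<ominus> s" by (simp add: ring_expand ring_cancel)
  finally show ?thesis .
qed

text \<open>Put w = c - a = b - d and u = a + b = c + d. Then 2 w.u = w.(a + b + c + d) = (c - a).(c
  + a) + (b - d).(b + d) = 0, and 2 is invertible.\<close>

lemma chord_orthogonal_sum:
  assumes V: "a \<in> V" "b \<in> V" "c \<in> V" "d \<in> V"
    and circle: "dot R a a = dot R c c" "dot R b b = dot R d d"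
    and sum: "vadd R a b = vadd R c d"
  shows "dot R (vdiff R c a) (vadd R a b) = \<zero>"
proof -
  let ?w = "vdiff R c a" and ?u = "vadd R a b"
  have w: "?w = vdiff R b d"
  proof -
    have V': "fst a \<in> carrier R" "snd a \<in> carrier R" "fst b \<in> carrier R" "snd b \<in> carrier R"
      "fst c \<in> carrier R" "snd c \<in> carrier R" "fst d \<in> carrier R" "snd d \<in> carrier R"
      using V by auto
    have "fst a \<oplus> fst b = fst c \<oplus> fst d" "snd a \<oplus> snd b = snd c \<oplus> snd d"
      using sum by (simp_all add: vadd_def)
    then show ?thesis
      unfolding vdiff_def using V' by (auto intro!: minus_eq_minus)
  qed
  have "dot R ?w ?u \<oplus> dot R ?w ?u = dot R ?w ?u \<oplus> dot R ?w (vadd R c d)" by (simp only: sum)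
  also have "\<dots> = dot R ?w (vadd R c a) \<oplus> dot R ?w (vadd R b d)"
    using V by (simp add: dot_vadd_right a_ac)
  also have "dot R ?w (vadd R c a) = \<zero>" using dot_vdiff_vadd[of c a] V circle by simp
  also have "dot R ?w (vadd R b d) = \<zero>" unfolding w using dot_vdiff_vadd[of b d] V circle by simp
  finally have "dot R ?w ?u \<oplus> dot R ?w ?u = \<zero>" by simp
  then show ?thesis by (rule double_eq_zero[rotated]) (use V in simp)
qed

text \<open>Both c - a and c - b are orthogonal to u = a + b, by the chord lemma for (a, b) and for
  (b, a). They are orthogonal to each other since c - b = (c + a) - u. Hence one of them is zero by
  \<open>orthogonal_triple\<close>.\<close>

lemma circle_sum_unique:
  assumes V: "a \<in> V" "b \<in> V" "c \<in> V" "d \<in> V"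
    and circle: "dot R a a = t" "dot R b b = t" "dot R c c = t" "dot R d d = t"
    and sum: "vadd R a b = vadd R c d"
    and nz: "vadd R a b \<noteq> (\<zero>, \<zero>)"
  shows "c = a \<and> d = b \<or> c = b \<and> d = a"
proof -
  let ?w = "vdiff R c a" and ?v = "vdiff R c b" and ?u = "vadd R a b"
  have comm: "vadd R b a = ?u" using V by (auto simp: vadd_def a_comm)
  have 1: "dot R ?w ?u = \<zero>" using chord_orthogonal_sum[of a b c d] V circle sum by simp
  have 2: "dot R ?v ?u = \<zero>" using chord_orthogonal_sum[of b a c d] V circle sum comm by simp
  have "dot R ?w ?v = dot R ?w (vadd R c a) \<ominus> dot R ?w ?u"
    using V by (simp add: dot_vadd_right dot_vdiff_right ring_expand ring_cancel)
  also have "\<dots> = \<zero>" using dot_vdiff_vadd[of c a] V circle 1 by simp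
  finally have 3: "dot R ?w ?v = \<zero>" .
  have "?v = (\<zero>, \<zero>) \<or> ?w = (\<zero>, \<zero>)"
    using orthogonal_triple[OF _ _ _ nz 1 2 3] V by simp
  then have "c = b \<or> c = a" using vdiff_eq_zero V by blast
  then show ?thesis
  proof
    assume c: "c = a"
    then show ?thesis using vadd_left_cancel[of a b d] sum V by simp
  next
    assume c: "c = b"
    then show ?thesis using vadd_left_cancel[of b a d] sum comm V by simp
  qed
qed

section \<open>Squared distances and completion of the square\<close>

lemma dot_self_vdiff: "x \<in> V \<Longrightarrow> y \<in> V \<Longrightarrow> sq_dist R x y = dot R (vdiff R x y) (vdiff R x y)"
  by (auto simp: sq_dist_def dot_def vdiff_def numeral_2_eq_2)

lemma vscale_closed [simp]: "c \<in> carrier R \<Longrightarrow> x \<in> V \<Longrightarrow> vscale R c x \<in> V"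
  by (auto simp: vscale_def)

text \<open>The factor 2c of the mixed term is moved into the vector \<open>u\<close>, so that this
  term becomes a linear phase in \<open>x\<close>.\<close>

lemma scale_sq_dist:
  assumes "c \<in> carrier R" "x \<in> V" "u \<in> V"
  shows "c \<otimes> sq_dist R x u = c \<otimes> dot R x x \<ominus> dot R x (vscale R (c \<oplus> c) u) \<oplus> c \<otimes> dot R u u"
  using assms by (auto simp: dot_self_vdiff) (auto simp: dot_def vscale_def vdiff_def ring_expand ring_cancel)

lemma double_nonzero: "s \<in> carrier R \<Longrightarrow> s \<noteq> \<zero> \<Longrightarrow> s \<oplus> s \<noteq> \<zero>"
  using double_eq_zero by blast

lemma double_inj:
  assumes "s \<in> carrier R" "t \<in> carrier R" "s \<oplus> s = t \<oplus> t"
  shows "s = t"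
proof -
  have "(s \<ominus> t) \<oplus> (s \<ominus> t) = (s \<oplus> s) \<ominus> (t \<oplus> t)" using assms(1,2) by (simp add: ring_expand)
  also have "\<dots> = \<zero>" using assms by (simp add: minus_eq r_neg)
  finally have "s \<ominus> t = \<zero>" by (rule double_eq_zero[rotated]) (use assms in simp)
  then show ?thesis using assms by simp
qed

text \<open>This is \<open>- 1 / (4 s)\<close>, the coefficient that appears when the square is completed.\<close>
definition dual :: "'a \<Rightarrow> 'a" where
  "dual s = \<ominus> (inv ((s \<oplus> s) \<oplus> (s \<oplus> s)))"

text \<open>The last equation is 4 r s = -1, in the form in which two successive scalings produce it
  in \<open>complete_square\<close>.\<close>

lemma dual_props:
  assumes s: "s \<in> carrier R" "s \<noteq> \<zero>"
  shows "dual s \<in> carrier R" "dual s \<noteq> \<zero>" "(dual s \<oplus> dual s) \<otimes> (s \<oplus> s) = \<ominus> \<one>"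
proof -
  let ?p = "s \<oplus> s"
  have p: "?p \<oplus> ?p \<in> Units R" using s by (simp add: field_Units double_nonzero)
  then have i: "inv (?p \<oplus> ?p) \<in> carrier R" by simp
  then show d: "dual s \<in> carrier R" by (simp add: dual_def)
  have "(dual s \<oplus> dual s) \<otimes> ?p = dual s \<otimes> (?p \<oplus> ?p)"
    using s d by (simp add: l_distr r_distr)
  also have "\<dots> = \<ominus> (inv (?p \<oplus> ?p) \<otimes> (?p \<oplus> ?p))"
    using s i by (simp add: dual_def l_minus)
  also have "\<dots> = \<ominus> \<one>" using p by simp
  finally show e: "(dual s \<oplus> dual s) \<otimes> ?p = \<ominus> \<one>" .
  show "dual s \<noteq> \<zero>"
  proof
    assume "dual s = \<zero>"
    then have "\<ominus> \<one> = \<zero>" using e s by simp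
    then show False using minus_minus[OF one_closed] one_not_zero by (metis minus_zero)
  qed
qed

text \<open>Inversion, negation and doubling are injective. This permits reindexing a sum over
  nonzero s by r = \<open>dual s\<close>.\<close>

lemma dual_inj: "inj_on dual (carrier R - {\<zero>})"
proof (rule inj_onI)
  fix s t assume s: "s \<in> carrier R - {\<zero>}" and t: "t \<in> carrier R - {\<zero>}" and eq: "dual s = dual t"
  have U: "(s \<oplus> s) \<oplus> (s \<oplus> s) \<in> Units R" "(t \<oplus> t) \<oplus> (t \<oplus> t) \<in> Units R"
    using s t by (simp_all add: field_Units double_nonzero)
  have "inv ((s \<oplus> s) \<oplus> (s \<oplus> s)) = inv ((t \<oplus> t) \<oplus> (t \<oplus> t))"
    using eq U unfolding dual_def by (metis Units_inv_closed minus_minus)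
  then have "(s \<oplus> s) \<oplus> (s \<oplus> s) = (t \<oplus> t) \<oplus> (t \<oplus> t)"
    using U by (metis Units_inv_inv)
  then have "s \<oplus> s = t \<oplus> t" using s t by (intro double_inj[of "s \<oplus> s" "t \<oplus> t"]) auto
  then show "s = t" using s t by (intro double_inj[of s t]) auto
qed

text \<open>With r = \<open>dual s\<close>, the mixed term of r |x - 2sz|^2 is -4rs x.z = x.z, and
  its constant term 4rs^2 z.z = -s z.z is cancelled by the last summand.\<close>

lemma complete_square:
  assumes s: "s \<in> carrier R" "s \<noteq> \<zero>" and V: "x \<in> V" "z \<in> V"
  shows "dual s \<otimes> dot R x x \<oplus> dot R x z
    = dual s \<otimes> sq_dist R x (vscale R (s \<oplus> s) z) \<oplus> s \<otimes> dot R z z"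
proof -
  note [simp] = s(1) dual_props(1)[OF s]
  let ?r = "dual s" and ?p = "s \<oplus> s"
  have assoc: "vscale R a (vscale R b z) = vscale R (a \<otimes> b) z" if "a \<in> carrier R" "b \<in> carrier R" for a b
    using V that by (auto simp: vscale_def m_assoc)
  have 1: "dot R x (vscale R (?r \<oplus> ?r) (vscale R ?p z)) = \<ominus> dot R x z"
  proof -
    have "dot R x (vscale R (?r \<oplus> ?r) (vscale R ?p z)) = dot R x (vscale R (\<ominus> \<one>) z)"
      by (simp add: assoc dual_props(3)[OF s])
    also have "\<dots> = \<ominus> dot R x z"
      using V by (auto simp: dot_def vscale_def l_minus r_minus minus_add)
    finally show ?thesis .
  qed
  have 2: "?r \<otimes> dot R (vscale R ?p z) (vscale R ?p z) = \<ominus> (s \<otimes> dot R z z)"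
  proof -
    have "?r \<otimes> dot R (vscale R ?p z) (vscale R ?p z) = (?r \<otimes> ?p \<otimes> ?p) \<otimes> dot R z z"
      using V by (auto simp: dot_def vscale_def ring_expand)
    also have "?r \<otimes> ?p \<otimes> ?p = ((?r \<oplus> ?r) \<otimes> ?p) \<otimes> s" by (simp add: ring_expand)
    also have "\<dots> = \<ominus> s" by (simp add: dual_props(3)[OF s] l_minus)
    finally show ?thesis using V by (simp add: l_minus)
  qed
  show ?thesis
    using V by (simp add: scale_sq_dist 1 2) (simp add: ring_expand ring_cancel)
qed

lemma vdiff_bij: "u \<in> V \<Longrightarrow> bij_betw (\<lambda>x. vdiff R x u) V V"
  by (rule bij_betw_byWitness[where f' = "\<lambda>x. vadd R x u"])
     (auto simp: vdiff_def vadd_def ring_expand ring_cancel)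

lemma sq_dist_closed [simp]: "x \<in> V \<Longrightarrow> y \<in> V \<Longrightarrow> sq_dist R x y \<in> carrier R"
  by (simp add: dot_self_vdiff)

lemma sq_dist_commute: "x \<in> V \<Longrightarrow> y \<in> V \<Longrightarrow> sq_dist R x y = sq_dist R y x"
  by (auto simp: sq_dist_def numeral_2_eq_2 ring_expand)

lemma card_V: "card V = (card (carrier R))\<^sup>2"
  by (simp add: power2_eq_square)

section \<open>Weighted additive energy of a circle\<close>

definition opp :: "'a \<times> 'a \<Rightarrow> 'a \<times> 'a" where "opp x = (\<ominus> fst x, \<ominus> snd x)"

lemma vadd_eq_zero:
  assumes "a \<in> V" "b \<in> V" "vadd R a b = (\<zero>, \<zero>)"
  shows "b = opp a"
  using assms by (auto simp: vadd_def opp_def prod_eq_iff) (metis minus_equality a_comm)+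

text \<open>By \<open>circle_sum_unique\<close> every solution of a + b = c + d on the circle has
  (c, d) = (a, b), or (c, d) = (b, a), or b = -a and d = -c. Each family contributes at most the
  square of the sum of (W a)^2, whence the constant 3.\<close>

lemma circle_energy:
  fixes W :: "'a \<times> 'a \<Rightarrow> real"
  assumes W: "\<And>a. W a \<ge> 0"
  defines "C \<equiv> \<lambda>t. {a \<in> V. dot R a a = t}"
  shows "(\<Sum>p\<in>C t \<times> C t. \<Sum>p'\<in>C t \<times> C t.
      if vadd R (fst p) (snd p) = vadd R (fst p') (snd p')
      then (W (fst p) * W (snd p)) * (W (fst p') * W (snd p')) else 0)
    \<le> 3 * (\<Sum>a\<in>C t. (W a)\<^sup>2)\<^sup>2"
proof -
  let ?C = "C t"
  let ?S = "\<Sum>a\<in>?C. (W a)\<^sup>2"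
  have fin: "finite ?C" by (rule finite_subset[of _ V]) (auto simp: C_def)
  have CV: "a \<in> V" "dot R a a = t" if "a \<in> ?C" for a using that by (auto simp: C_def)
  have opp_C: "opp a \<in> ?C" if "a \<in> ?C" for a
    using that by (auto simp: C_def opp_def dot_def l_minus r_minus)
  have opp_opp: "opp (opp a) = a" if "a \<in> ?C" for a
    using that by (auto simp: C_def opp_def)
  have opp_bij: "bij_betw opp ?C ?C"
    by (rule bij_betw_byWitness[where f' = opp]) (auto simp: opp_opp opp_C)
  let ?P = "\<lambda>a b c d. (W a * W b) * (W c * W d)"
  have P: "?P a b c d \<ge> 0" for a b c d using W by simp
  \<comment> \<open>The families may overlap, which only enlarges the right side. Nested
    conditionals, one equation each, let the inner sums collapse one index at a time.\<close>
  have indicators: "X \<le> (if A1 then if A2 then X else 0 else 0)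
       + (if B1 then if B2 then X else 0 else 0) + (if C1 then if C2 then X else 0 else 0)"
    if "0 \<le> X" "A1 \<and> A2 \<or> B1 \<and> B2 \<or> C1 \<and> C2" for X :: real and A1 A2 B1 B2 C1 C2
    using that by auto
  have "(\<Sum>p\<in>?C \<times> ?C. \<Sum>p'\<in>?C \<times> ?C.
      if vadd R (fst p) (snd p) = vadd R (fst p') (snd p')
      then (W (fst p) * W (snd p)) * (W (fst p') * W (snd p')) else 0)
    = (\<Sum>a\<in>?C. \<Sum>b\<in>?C. \<Sum>c\<in>?C. \<Sum>d\<in>?C. if vadd R a b = vadd R c d then ?P a b c d else 0)"
    unfolding sum.cartesian_product' fst_conv snd_conv ..
  also have "\<dots> \<le> (\<Sum>a\<in>?C. \<Sum>b\<in>?C. \<Sum>c\<in>?C. \<Sum>d\<in>?C. (if a = c then if b = d then ?P a b c d else 0 else 0)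
       + (if b = c then if a = d then ?P a b c d else 0 else 0)
       + (if opp a = b then if opp c = d then ?P a b c d else 0 else 0))"
  proof (intro sum_mono)
    fix a b c d assume abcd: "a \<in> ?C" "b \<in> ?C" "c \<in> ?C" "d \<in> ?C"
    let ?R = "(if a = c then if b = d then ?P a b c d else 0 else 0)
       + (if b = c then if a = d then ?P a b c d else 0 else 0)
       + (if opp a = b then if opp c = d then ?P a b c d else 0 else 0)"
    have R0: "?R \<ge> 0" using P by simp
    show "(if vadd R a b = vadd R c d then ?P a b c d else 0) \<le> ?R"
    proof (cases "vadd R a b = vadd R c d")
      case True
      have "(c = a \<and> d = b) \<or> (c = b \<and> d = a) \<or> (b = opp a \<and> d = opp c)"
      proof (cases "vadd R a b = (\<zero>, \<zero>)")
        case zero: True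
        then show ?thesis using vadd_eq_zero CV abcd True by simp
      next
        case False
        then show ?thesis using circle_sum_unique[of a b c d t] CV abcd True by blast
      qed
      then have "?P a b c d \<le> ?R"
        by (intro indicators P) auto
      then show ?thesis using True by simp
    next
      case False
      then show ?thesis using R0 by simp
    qed
  qed
  also have "\<dots> = ?S\<^sup>2 + ?S\<^sup>2 + (\<Sum>a\<in>?C. W a * W (opp a))\<^sup>2"
  proof -
    have 1: "(\<Sum>c\<in>?C. \<Sum>d\<in>?C. if a = c then if b = d then ?P a b c d else 0 else 0) = (W a)\<^sup>2 * (W b)\<^sup>2"
      if "a \<in> ?C" "b \<in> ?C" for a b
    proof -
      have "(\<Sum>c\<in>?C. \<Sum>d\<in>?C. if a = c then if b = d then ?P a b c d else 0 else 0)
        = (\<Sum>c\<in>?C. if a = c then \<Sum>d\<in>?C. if b = d then ?P a b c d else 0 else 0)"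
        by (intro sum.cong refl) simp
      then show ?thesis using that fin by (simp add: power2_eq_square)
    qed
    have 2: "(\<Sum>c\<in>?C. \<Sum>d\<in>?C. if b = c then if a = d then ?P a b c d else 0 else 0) = (W a)\<^sup>2 * (W b)\<^sup>2"
      if "a \<in> ?C" "b \<in> ?C" for a b
    proof -
      have "(\<Sum>c\<in>?C. \<Sum>d\<in>?C. if b = c then if a = d then ?P a b c d else 0 else 0)
        = (\<Sum>c\<in>?C. if b = c then \<Sum>d\<in>?C. if a = d then ?P a b c d else 0 else 0)"
        by (intro sum.cong refl) simp
      then show ?thesis using that fin by (simp add: power2_eq_square)
    qed
    have 3: "(\<Sum>b\<in>?C. \<Sum>c\<in>?C. \<Sum>d\<in>?C. if opp a = b then if opp c = d then ?P a b c d else 0 else 0)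
      = (\<Sum>c\<in>?C. (W a * W (opp a)) * (W c * W (opp c)))" if "a \<in> ?C" for a
    proof -
      have "(\<Sum>b\<in>?C. \<Sum>c\<in>?C. \<Sum>d\<in>?C. if opp a = b then if opp c = d then ?P a b c d else 0 else 0)
        = (\<Sum>b\<in>?C. if opp a = b then \<Sum>c\<in>?C. \<Sum>d\<in>?C. if opp c = d then ?P a b c d else 0 else 0)"
        by (intro sum.cong refl) simp
      also have "\<dots> = (\<Sum>c\<in>?C. \<Sum>d\<in>?C. if opp c = d then ?P a (opp a) c d else 0)"
        using fin opp_C[OF that] by simp
      also have "\<dots> = (\<Sum>c\<in>?C. (W a * W (opp a)) * (W c * W (opp c)))"
        using fin opp_C by (intro sum.cong refl) simp
      finally show ?thesis .
    qed
    have S2: "(\<Sum>a\<in>?C. \<Sum>b\<in>?C. (W a)\<^sup>2 * (W b)\<^sup>2) = ?S\<^sup>2"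
      by (simp add: power2_eq_square sum_product)
    have O2: "(\<Sum>a\<in>?C. \<Sum>c\<in>?C. (W a * W (opp a)) * (W c * W (opp c))) = (\<Sum>a\<in>?C. W a * W (opp a))\<^sup>2"
      by (simp add: power2_eq_square sum_product)
    show ?thesis
      by (simp only: sum.distrib 1 2 3 S2 O2 cong: sum.cong)
  qed
  \<comment> \<open>The antipodal family: 2xy \<le> x^2 + y^2 in each term, and \<open>opp\<close>
    permutes the circle.\<close>
  also have "(\<Sum>a\<in>?C. W a * W (opp a))\<^sup>2 \<le> ?S\<^sup>2"
  proof (rule power_mono)
    have "(\<Sum>a\<in>?C. W a * W (opp a)) \<le> (\<Sum>a\<in>?C. ((W a)\<^sup>2 + (W (opp a))\<^sup>2) / 2)"
    proof (intro sum_mono)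
      show "W a * W (opp a) \<le> ((W a)\<^sup>2 + (W (opp a))\<^sup>2) / 2" for a
        using sum_squares_bound[of "W a" "W (opp a)"] by simp
    qed
    also have "\<dots> = (?S + (\<Sum>a\<in>?C. (W (opp a))\<^sup>2)) / 2"
      by (simp add: sum.distrib sum_divide_distrib[symmetric])
    also have "(\<Sum>a\<in>?C. (W (opp a))\<^sup>2) = ?S"
      by (rule sum.reindex_bij_betw[OF opp_bij])
    finally show "(\<Sum>a\<in>?C. W a * W (opp a)) \<le> ?S" by simp
    show "0 \<le> (\<Sum>a\<in>?C. W a * W (opp a))" using W by (simp add: sum_nonneg)
  qed
  finally show ?thesis by simp
qed

end

section \<open>Character sums\<close>

text \<open>The witness \<open>a0\<close> says that \<chi> is nontrivial. Modulus one is asked on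
  the whole type, so that simplification with it has no membership conditions.\<close>

locale field_character = field_3mod4 +
  fixes \<chi> :: "'a \<Rightarrow> complex" and a0 :: 'a
  assumes \<chi>_add: "a \<in> carrier R \<Longrightarrow> b \<in> carrier R \<Longrightarrow> \<chi> (a \<oplus> b) = \<chi> a * \<chi> b"
    and norm_\<chi> [simp]: "cmod (\<chi> a) = 1"
    and a0: "a0 \<in> carrier R" "\<chi> a0 \<noteq> 1"
begin

definition q :: real where "q = real (card (carrier R))"

lemma q_pos: "q > 0"
  using finite_carrier zero_closed by (auto simp: q_def card_gt_0_iff)

lemma \<chi>_nonzero [simp]: "\<chi> a \<noteq> 0"
  using norm_\<chi>[of a] by force

lemma \<chi>_cnj_self: "\<chi> a * cnj (\<chi> a) = 1"
  by (simp add: complex_norm_square[symmetric] del: of_real_power)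

lemma \<chi>_zero [simp]: "\<chi> \<zero> = 1"
  using \<chi>_add[of \<zero> \<zero>] by simp

lemma \<chi>_neg: "a \<in> carrier R \<Longrightarrow> \<chi> (\<ominus> a) = cnj (\<chi> a)"
proof -
  assume a: "a \<in> carrier R"
  have "\<chi> a * \<chi> (\<ominus> a) = \<chi> a * cnj (\<chi> a)"
    using \<chi>_add[of a "\<ominus> a"] a by (simp add: r_neg \<chi>_cnj_self)
  then show ?thesis by simp
qed

lemma \<chi>_diff: "a \<in> carrier R \<Longrightarrow> b \<in> carrier R \<Longrightarrow> \<chi> (a \<ominus> b) = \<chi> a * cnj (\<chi> b)"
  by (simp add: minus_eq \<chi>_add \<chi>_neg)

section \<open>Orthogonality relations\<close>

lemma sum_\<chi>: "(\<Sum>s\<in>carrier R. \<chi> s) = 0"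
proof -
  have "bij_betw (\<lambda>s. a0 \<oplus> s) (carrier R) (carrier R)"
    by (rule bij_betw_byWitness[where f' = "\<lambda>s. \<ominus> a0 \<oplus> s"]) (use a0 in \<open>auto simp: r_neg1 r_neg2\<close>)
  then have "(\<Sum>s\<in>carrier R. \<chi> (a0 \<oplus> s)) = (\<Sum>s\<in>carrier R. \<chi> s)"
    by (rule sum.reindex_bij_betw)
  then have "\<chi> a0 * (\<Sum>s\<in>carrier R. \<chi> s) = (\<Sum>s\<in>carrier R. \<chi> s)"
    using a0 by (simp add: \<chi>_add sum_distrib_left)
  then show ?thesis using a0 by simp
qed

lemma sum_\<chi>_mult:
  assumes b: "b \<in> carrier R"
  shows "(\<Sum>s\<in>carrier R. \<chi> (s \<otimes> b)) = (if b = \<zero> then of_real q else 0)"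
proof (cases "b = \<zero>")
  case True
  then show ?thesis by (simp add: q_def)
next
  case False
  then have U: "b \<in> Units R" using b by (simp add: field_Units)
  have "bij_betw (\<lambda>s. s \<otimes> b) (carrier R) (carrier R)"
    by (rule bij_betw_byWitness[where f' = "\<lambda>s. s \<otimes> inv b"]) (use U b in \<open>auto simp: m_assoc\<close>)
  then have "(\<Sum>s\<in>carrier R. \<chi> (s \<otimes> b)) = (\<Sum>s\<in>carrier R. \<chi> s)"
    by (rule sum.reindex_bij_betw)
  then show ?thesis using False sum_\<chi> by simp
qed

lemma orthogonality:
  assumes "a \<in> carrier R" "b \<in> carrier R"
  shows "(\<Sum>s\<in>carrier R. \<chi> (s \<otimes> a) * cnj (\<chi> (s \<otimes> b))) = (if a = b then of_real q else 0)"
proof -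
  have "(\<Sum>s\<in>carrier R. \<chi> (s \<otimes> a) * cnj (\<chi> (s \<otimes> b))) = (\<Sum>s\<in>carrier R. \<chi> (s \<otimes> (a \<ominus> b)))"
    using assms by (intro sum.cong refl) (simp add: \<chi>_diff[symmetric] minus_eq r_distr r_minus)
  then show ?thesis using assms by (simp add: sum_\<chi>_mult)
qed

lemma orthogonality_plane:
  assumes "u \<in> V" "v \<in> V"
  shows "(\<Sum>x\<in>V. \<chi> (dot R x u) * cnj (\<chi> (dot R x v))) = (if u = v then of_real (q\<^sup>2) else 0)"
proof -
  obtain u1 u2 v1 v2 where eqs: "u = (u1, u2)" "v = (v1, v2)"
    and [simp]: "u1 \<in> carrier R" "u2 \<in> carrier R" "v1 \<in> carrier R" "v2 \<in> carrier R"
    using assms by auto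
  have "(\<Sum>x\<in>V. \<chi> (dot R x u) * cnj (\<chi> (dot R x v)))
    = (\<Sum>a\<in>carrier R. \<Sum>b\<in>carrier R. (\<chi> (a \<otimes> u1) * cnj (\<chi> (a \<otimes> v1))) * (\<chi> (b \<otimes> u2) * cnj (\<chi> (b \<otimes> v2))))"
    unfolding sum.cartesian_product' by (intro sum.cong refl) (simp add: eqs dot_def \<chi>_add)
  also have "\<dots> = (\<Sum>a\<in>carrier R. \<chi> (a \<otimes> u1) * cnj (\<chi> (a \<otimes> v1))) * (\<Sum>b\<in>carrier R. \<chi> (b \<otimes> u2) * cnj (\<chi> (b \<otimes> v2)))"
    by (simp only: sum_product)
  also have "\<dots> = (if u = v then of_real (q\<^sup>2) else 0)"
    by (simp add: orthogonality eqs power2_eq_square)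
  finally show ?thesis .
qed

text \<open>In |x - u|^2 - |x - v|^2 the term x.x cancels, which leaves a constant phase times the
  linear character of frequency 2s(v - u). Thus the kernel \<chi>(s |x - y|) on the plane is q times
  a unitary matrix.\<close>

lemma orthogonality_sq_dist:
  assumes s: "s \<in> carrier R" "s \<noteq> \<zero>" and V: "u \<in> V" "v \<in> V"
  shows "(\<Sum>x\<in>V. \<chi> (s \<otimes> sq_dist R x u) * cnj (\<chi> (s \<otimes> sq_dist R x v)))
    = (if u = v then of_real (q\<^sup>2) else 0)"
proof -
  let ?d = "\<lambda>u. vscale R (s \<oplus> s) u"
  have inj: "?d v = ?d u \<longleftrightarrow> u = v"
    using s V double_nonzero by (auto simp: vscale_def m_lcancel)
  have "(\<Sum>x\<in>V. \<chi> (s \<otimes> sq_dist R x u) * cnj (\<chi> (s \<otimes> sq_dist R x v)))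
    = (\<Sum>x\<in>V. (\<chi> (s \<otimes> dot R u u) * cnj (\<chi> (s \<otimes> dot R v v)))
        * (\<chi> (dot R x (?d v)) * cnj (\<chi> (dot R x (?d u)))))"
  proof (intro sum.cong refl)
    fix x assume x: "x \<in> V"
    have "\<chi> (s \<otimes> sq_dist R x u) = \<chi> (s \<otimes> dot R x x) * cnj (\<chi> (dot R x (?d u))) * \<chi> (s \<otimes> dot R u u)"
      and "\<chi> (s \<otimes> sq_dist R x v) = \<chi> (s \<otimes> dot R x x) * cnj (\<chi> (dot R x (?d v))) * \<chi> (s \<otimes> dot R v v)"
      using x s V by (simp_all add: scale_sq_dist \<chi>_add \<chi>_diff)
    then show "\<chi> (s \<otimes> sq_dist R x u) * cnj (\<chi> (s \<otimes> sq_dist R x v))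
      = (\<chi> (s \<otimes> dot R u u) * cnj (\<chi> (s \<otimes> dot R v v))) * (\<chi> (dot R x (?d v)) * cnj (\<chi> (dot R x (?d u))))"
      using \<chi>_cnj_self[of "s \<otimes> dot R x x"] by (simp add: algebra_simps)
  qed
  also have "\<dots> = (\<chi> (s \<otimes> dot R u u) * cnj (\<chi> (s \<otimes> dot R v v))) * (if u = v then of_real (q\<^sup>2) else 0)"
    using s V by (simp only: sum_distrib_left[symmetric]) (simp add: orthogonality_plane inj)
  also have "\<dots> = (if u = v then of_real (q\<^sup>2) else 0)"
    by (simp add: \<chi>_cnj_self)
  finally show ?thesis .
qed

section \<open>Quadratic Gauss sums of the plane\<close>

definition gauss :: "'a \<Rightarrow> complex" where
  "gauss r = (\<Sum>x\<in>V. \<chi> (r \<otimes> dot R x x))"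

lemma sum_sq_dist:
  assumes "u \<in> V"
  shows "(\<Sum>x\<in>V. \<chi> (r \<otimes> sq_dist R x u)) = gauss r"
proof -
  have "(\<Sum>x\<in>V. \<chi> (r \<otimes> sq_dist R x u)) = (\<Sum>x\<in>V. \<chi> (r \<otimes> dot R (vdiff R x u) (vdiff R x u)))"
    using assms by (intro sum.cong refl) (simp add: dot_self_vdiff)
  also have "\<dots> = gauss r"
    unfolding gauss_def by (rule sum.reindex_bij_betw[OF vdiff_bij[OF assms]])
  finally show ?thesis .
qed

text \<open>Parseval for the distance kernel with unit weights: by translation every row sum equals
  the Gauss sum, so |V| |gauss r|^2 = q^2 |V|.\<close>

lemma cmod_gauss:
  assumes r: "r \<in> carrier R" "r \<noteq> \<zero>"
  shows "cmod (gauss r) = q"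
proof -
  have cV: "real (card V) = q\<^sup>2" by (simp only: card_V q_def of_nat_power)
  have "(\<Sum>x\<in>V. (cmod (\<Sum>u\<in>V. 1 * \<chi> (r \<otimes> sq_dist R x u)))\<^sup>2) = q\<^sup>2 * (\<Sum>u\<in>V. (cmod 1)\<^sup>2)"
    by (rule parseval_inj) (simp_all add: orthogonality_sq_dist[OF r] del: of_real_power)
  moreover have "(\<Sum>u\<in>V. 1 * \<chi> (r \<otimes> sq_dist R x u)) = gauss r" if "x \<in> V" for x
    using sum_sq_dist[OF that, of r] sq_dist_commute[OF that] by (simp cong: sum.cong)
  ultimately have "q\<^sup>2 * (cmod (gauss r))\<^sup>2 = q\<^sup>2 * q\<^sup>2"
    using cV by (simp cong: sum.cong)
  then have "(cmod (gauss r))\<^sup>2 = q\<^sup>2" by (subst (asm) mult_left_cancel) (use q_pos in auto)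
  then show ?thesis by (rule power2_eq_imp_eq) (use q_pos in simp_all)
qed

end

section \<open>Exponential sums of a point set\<close>

locale field_character_set = field_character +
  fixes E :: "('a \<times> 'a) set"
  assumes E_sub: "E \<subseteq> carrier R \<times> carrier R"
begin

lemma finite_E [simp]: "finite E"
  using E_sub by (rule finite_subset) simp

lemma E_V: "x \<in> E \<Longrightarrow> x \<in> V"
  using E_sub by auto

definition n :: real where "n = real (card E)"

definition \<nu> :: "'a \<Rightarrow> complex" where
  "\<nu> s = (\<Sum>x\<in>E. \<Sum>y\<in>E. \<chi> (s \<otimes> sq_dist R x y))"

definition F :: "'a \<times> 'a \<Rightarrow> complex" where
  "F \<xi> = (\<Sum>x\<in>E. \<chi> (dot R \<xi> x))"

text \<open>Grouped by the norm of \<xi>, this is the Fourier transform of the circle masses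
  \<open>S\<close>.\<close>

definition T :: "'a \<Rightarrow> complex" where
  "T r = (\<Sum>\<xi>\<in>V. of_real ((cmod (F \<xi>))\<^sup>2) * \<chi> (r \<otimes> dot R \<xi> \<xi>))"

definition S :: "'a \<Rightarrow> real" where
  "S t = (\<Sum>\<xi> | \<xi> \<in> V \<and> dot R \<xi> \<xi> = t. (cmod (F \<xi>))\<^sup>2)"

lemma \<nu>_zero: "\<nu> \<zero> = of_real (n\<^sup>2)"
proof -
  have "\<nu> \<zero> = (\<Sum>x\<in>E. \<Sum>y\<in>E. 1)"
    unfolding \<nu>_def by (intro sum.cong refl) (simp add: E_V)
  then show ?thesis by (simp add: n_def power2_eq_square)
qed

text \<open>Cauchy-Schwarz in x, enlargement of the range of x from \<open>E\<close> to the plane,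
  and Parseval for the distance kernel give |\<nu> s|^2 \<le> n (q^2 n).\<close>

lemma cmod_\<nu>_le:
  assumes s: "s \<in> carrier R" "s \<noteq> \<zero>"
  shows "cmod (\<nu> s) \<le> q * n"
proof -
  let ?h = "\<lambda>x. \<Sum>y\<in>E. 1 * \<chi> (s \<otimes> sq_dist R x y)"
  have "(cmod (\<nu> s))\<^sup>2 \<le> (\<Sum>x\<in>E. cmod (?h x))\<^sup>2"
    unfolding \<nu>_def by (intro power_mono) (simp_all add: norm_sum)
  also have "\<dots> \<le> (\<Sum>x\<in>E. (cmod (?h x))\<^sup>2) * n"
    unfolding n_def by (rule sum_squared_le_sum_of_squares)
  also have "\<dots> \<le> (\<Sum>x\<in>V. (cmod (?h x))\<^sup>2) * n"
    using E_sub by (intro mult_right_mono sum_mono2) (auto simp: n_def)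
  also have "(\<Sum>x\<in>V. (cmod (?h x))\<^sup>2) = q\<^sup>2 * (\<Sum>y\<in>E. (cmod 1)\<^sup>2)"
    by (rule parseval_inj) (simp_all add: orthogonality_sq_dist[OF s] E_V del: of_real_power)
  also have "\<dots> * n = (q * n)\<^sup>2" by (simp add: n_def power2_eq_square)
  finally show ?thesis
    by (rule power2_le_imp_le) (use q_pos in \<open>simp add: n_def\<close>)
qed

lemma sum_cmod_F: "(\<Sum>\<xi>\<in>V. (cmod (F \<xi>))\<^sup>2) = q\<^sup>2 * n"
proof -
  have "(\<Sum>\<xi>\<in>V. (cmod (\<Sum>x\<in>E. 1 * \<chi> (dot R \<xi> x)))\<^sup>2) = q\<^sup>2 * (\<Sum>x\<in>E. (cmod 1)\<^sup>2)"
    by (rule parseval_inj) (simp_all add: orthogonality_plane E_V del: of_real_power)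
  then show ?thesis by (simp add: F_def n_def)
qed

text \<open>Opening |F|^2 gives the phase r \<xi>.\<xi> + \<xi>.(x - y), which completes to r |\<xi>
  - 2s(x - y)|^2 + s |x - y|^2. The sum over \<xi> is then a translated Gauss sum, the same for all
  x and y.\<close>

lemma T_dual:
  assumes s: "s \<in> carrier R" "s \<noteq> \<zero>"
  shows "T (dual s) = gauss (dual s) * \<nu> s"
proof -
  let ?r = "dual s"
  note d = dual_props(1)[OF s]
  have "T ?r = (\<Sum>\<xi>\<in>V. \<Sum>x\<in>E. \<Sum>y\<in>E. \<chi> (?r \<otimes> dot R \<xi> \<xi> \<oplus> dot R \<xi> (vdiff R x y)))"
    unfolding T_def
  proof (intro sum.cong refl)
    fix \<xi> assume \<xi>: "\<xi> \<in> V"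
    have "of_real ((cmod (F \<xi>))\<^sup>2) * \<chi> (?r \<otimes> dot R \<xi> \<xi>)
      = (\<Sum>x\<in>E. \<Sum>y\<in>E. (\<chi> (dot R \<xi> x) * cnj (\<chi> (dot R \<xi> y))) * \<chi> (?r \<otimes> dot R \<xi> \<xi>))"
      unfolding complex_norm_square F_def cnj_sum sum_product by (simp only: sum_distrib_right)
    also have "\<dots> = (\<Sum>x\<in>E. \<Sum>y\<in>E. \<chi> (?r \<otimes> dot R \<xi> \<xi> \<oplus> dot R \<xi> (vdiff R x y)))"
      using d \<xi> by (intro sum.cong refl) (simp add: \<chi>_add \<chi>_diff dot_vdiff_right E_V)
    finally show "of_real ((cmod (F \<xi>))\<^sup>2) * \<chi> (?r \<otimes> dot R \<xi> \<xi>)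
      = (\<Sum>x\<in>E. \<Sum>y\<in>E. \<chi> (?r \<otimes> dot R \<xi> \<xi> \<oplus> dot R \<xi> (vdiff R x y)))" .
  qed
  also have "\<dots> = (\<Sum>x\<in>E. \<Sum>y\<in>E. \<Sum>\<xi>\<in>V. \<chi> (?r \<otimes> dot R \<xi> \<xi> \<oplus> dot R \<xi> (vdiff R x y)))"
    by (subst sum.swap, rule sum.cong[OF refl], rule sum.swap)
  also have "\<dots> = (\<Sum>x\<in>E. \<Sum>y\<in>E. gauss ?r * \<chi> (s \<otimes> sq_dist R x y))"
  proof (intro sum.cong refl)
    fix x y assume xy: "x \<in> E" "y \<in> E"
    let ?z = "vdiff R x y"
    have z: "?z \<in> V" using xy E_V by simp
    have "(\<Sum>\<xi>\<in>V. \<chi> (?r \<otimes> dot R \<xi> \<xi> \<oplus> dot R \<xi> ?z))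
      = (\<Sum>\<xi>\<in>V. \<chi> (?r \<otimes> sq_dist R \<xi> (vscale R (s \<oplus> s) ?z)) * \<chi> (s \<otimes> dot R ?z ?z))"
      using z s d by (intro sum.cong refl) (simp add: complete_square \<chi>_add)
    also have "\<dots> = gauss ?r * \<chi> (s \<otimes> sq_dist R x y)"
      using z s xy dot_self_vdiff[of x y] E_V by (simp add: sum_distrib_right[symmetric] sum_sq_dist)
    finally show "(\<Sum>\<xi>\<in>V. \<chi> (?r \<otimes> dot R \<xi> \<xi> \<oplus> dot R \<xi> ?z)) = gauss ?r * \<chi> (s \<otimes> sq_dist R x y)" .
  qed
  also have "\<dots> = gauss ?r * \<nu> s" by (simp add: \<nu>_def sum_distrib_left)
  finally show ?thesis .
qed

text \<open>Parseval over the frequency r: the fibres of the squared norm are circles, and the fibre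
  sums are the real numbers \<open>S t\<close>.\<close>

lemma sum_T: "(\<Sum>r\<in>carrier R. (cmod (T r))\<^sup>2) = q * (\<Sum>t\<in>carrier R. (S t)\<^sup>2)"
proof -
  have "(\<Sum>r\<in>carrier R. (cmod (T r))\<^sup>2) = q * (\<Sum>t\<in>carrier R.
      (cmod (\<Sum>\<xi> | \<xi> \<in> V \<and> dot R \<xi> \<xi> = t. of_real ((cmod (F \<xi>))\<^sup>2)))\<^sup>2)"
    unfolding T_def
    by (rule parseval_fibres[where e = "\<lambda>r \<xi>. \<chi> (r \<otimes> dot R \<xi> \<xi>)"]) (auto simp add: orthogonality simp del: of_real_power)
  then show ?thesis
    unfolding of_real_sum[symmetric] norm_of_real S_def by simp
qed

section \<open>Restriction estimate for circles\<close>

lemma S_nonneg: "S t \<ge> 0"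
  unfolding S_def by (simp add: sum_nonneg)

text \<open>Restriction by duality. \<open>S t\<close> is the sum over \<open>E\<close> of the
  function h that extends the conjugate of \<open>F\<close> from the circle. Hoelder and
  \<open>circle_energy\<close> give S^4 \<le> n^3 q^2 (3 S^2), and S^2 is divided out.\<close>

lemma S_le: "S t \<le> q * sqrt (3 * n ^ 3)"
proof -
  define C where "C = {\<xi> \<in> V. dot R \<xi> \<xi> = t}"
  have finC [simp]: "finite C" by (rule finite_subset[of _ V]) (auto simp: C_def)
  have CV: "\<xi> \<in> V" if "\<xi> \<in> C" for \<xi> using that by (simp add: C_def)
  have vadd_C: "vadd R (fst p) (snd p) \<in> V" if "p \<in> C \<times> C" for p
    using that by (intro vadd_closed CV) auto
  define w where "w \<xi> = cnj (F \<xi>)" for \<xi>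
  define h where "h x = (\<Sum>\<xi>\<in>C. w \<xi> * \<chi> (dot R x \<xi>))" for x
  have S_C: "S t = (\<Sum>\<xi>\<in>C. (cmod (F \<xi>))\<^sup>2)" by (simp add: S_def C_def)
  have "complex_of_real (S t) = (\<Sum>\<xi>\<in>C. F \<xi> * w \<xi>)"
    unfolding S_C of_real_sum complex_norm_square w_def ..
  also have "\<dots> = (\<Sum>\<xi>\<in>C. \<Sum>x\<in>E. w \<xi> * \<chi> (dot R x \<xi>))"
    using CV by (intro sum.cong refl) (simp add: F_def sum_distrib_left mult.commute dot_commute E_V)
  also have "\<dots> = (\<Sum>x\<in>E. h x)" unfolding h_def by (rule sum.swap)
  finally have "complex_of_real (S t) = (\<Sum>x\<in>E. h x)" .
  then have "S t = cmod (\<Sum>x\<in>E. h x)" using S_nonneg[of t] by (metis abs_of_nonneg norm_of_real)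
  then have "S t \<le> (\<Sum>x\<in>E. cmod (h x))" using norm_sum by metis
  then have "S t ^ 4 \<le> (\<Sum>x\<in>E. cmod (h x)) ^ 4" using S_nonneg by (rule power_mono)
  also have "\<dots> \<le> n ^ 3 * (\<Sum>x\<in>E. cmod (h x) ^ 4)" unfolding n_def by (rule sum_power4_le)
  also have "\<dots> \<le> n ^ 3 * (\<Sum>x\<in>V. cmod (h x) ^ 4)"
    using E_sub by (intro mult_left_mono sum_mono2) (auto simp: n_def)
  \<comment> \<open>The square of h is an exponential sum over pairs of points of the circle, with
    frequency their vector sum; its second moment therefore measures additive energy.\<close>
  also have "(\<Sum>x\<in>V. cmod (h x) ^ 4)
    = (\<Sum>x\<in>V. (cmod (\<Sum>p\<in>C \<times> C. (w (fst p) * w (snd p)) * \<chi> (dot R x (vadd R (fst p) (snd p)))))\<^sup>2)"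
  proof (intro sum.cong refl)
    fix x assume x: "x \<in> V"
    have "(\<Sum>p\<in>C \<times> C. (w (fst p) * w (snd p)) * \<chi> (dot R x (vadd R (fst p) (snd p)))) = h x * h x"
      unfolding h_def sum_product sum.cartesian_product' fst_conv snd_conv
      using x CV by (intro sum.cong refl) (simp add: dot_vadd_right \<chi>_add mult_ac)
    then show "cmod (h x) ^ 4
      = (cmod (\<Sum>p\<in>C \<times> C. (w (fst p) * w (snd p)) * \<chi> (dot R x (vadd R (fst p) (snd p)))))\<^sup>2"
      by (simp add: norm_mult power2_eq_square power4_eq_xxxx)
  qed
  also have "\<dots> \<le> q\<^sup>2 * (\<Sum>p\<in>C \<times> C. \<Sum>p'\<in>C \<times> C.
      if vadd R (fst p) (snd p) = vadd R (fst p') (snd p')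
      then cmod (w (fst p) * w (snd p)) * cmod (w (fst p') * w (snd p')) else 0)"
    by (rule parseval_le) (simp_all add: orthogonality_plane vadd_C del: of_real_power)
  also have "\<dots> \<le> q\<^sup>2 * (3 * (\<Sum>\<xi>\<in>C. (cmod (w \<xi>))\<^sup>2)\<^sup>2)"
    unfolding norm_mult C_def by (intro mult_left_mono circle_energy) simp_all
  also have "(\<Sum>\<xi>\<in>C. (cmod (w \<xi>))\<^sup>2) = S t" by (simp add: w_def S_C)
  finally have "S t ^ 4 \<le> n ^ 3 * (q\<^sup>2 * (3 * (S t)\<^sup>2))"
    by (simp add: n_def mult_left_mono)
  then have "(S t)\<^sup>2 * (S t)\<^sup>2 \<le> (q * sqrt (3 * n ^ 3))\<^sup>2 * (S t)\<^sup>2"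
    by (simp add: power_mult_distrib n_def power4_eq_xxxx power2_eq_square mult_ac)
  \<comment> \<open>The mass of a circle may vanish, so the cancellation needs this case
    apart.\<close>
  then have "S t = 0 \<or> (S t)\<^sup>2 \<le> (q * sqrt (3 * n ^ 3))\<^sup>2"
    by (metis mult_le_cancel_right zero_le_power2 zero_eq_power2 order_le_less)
  then show ?thesis
    using q_pos by (auto simp: n_def intro: power2_le_imp_le)
qed

section \<open>Second and fourth moments of \<nu>\<close>

text \<open>\<open>T_dual\<close> and |gauss| = q turn the moment of \<nu> into one of
  \<open>T\<close>, hence into the sum of (S t)^2. One factor \<open>S t\<close> is bounded by
  \<open>S_le\<close>; the other is summed over t to the total mass q^2 n.\<close>

lemma sum_cmod_\<nu>: "(\<Sum>s\<in>carrier R - {\<zero>}. (cmod (\<nu> s))\<^sup>2) \<le> q\<^sup>2 * n * sqrt (3 * n ^ 3)"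
proof -
  have "q\<^sup>2 * (\<Sum>s\<in>carrier R - {\<zero>}. (cmod (\<nu> s))\<^sup>2) = (\<Sum>s\<in>carrier R - {\<zero>}. (cmod (T (dual s)))\<^sup>2)"
    unfolding sum_distrib_left
    by (intro sum.cong refl) (simp add: T_dual norm_mult cmod_gauss dual_props power_mult_distrib)
  also have "\<dots> = (\<Sum>r\<in>dual ` (carrier R - {\<zero>}). (cmod (T r))\<^sup>2)"
    using sum.reindex[OF dual_inj, of "\<lambda>r. (cmod (T r))\<^sup>2"] by simp
  \<comment> \<open>Parseval needs all frequencies r; those outside the image of \<open>dual\<close>
    contribute nonnegative terms.\<close>
  also have "\<dots> \<le> (\<Sum>r\<in>carrier R. (cmod (T r))\<^sup>2)"
    by (intro sum_mono2) (auto intro: dual_props(1))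
  also have "\<dots> = q * (\<Sum>t\<in>carrier R. S t * S t)" unfolding sum_T by (simp add: power2_eq_square)
  also have "\<dots> \<le> q * (\<Sum>t\<in>carrier R. (q * sqrt (3 * n ^ 3)) * S t)"
    using q_pos by (intro mult_left_mono sum_mono mult_right_mono S_le S_nonneg) auto
  also have "(\<Sum>t\<in>carrier R. (q * sqrt (3 * n ^ 3)) * S t) = (q * sqrt (3 * n ^ 3)) * (\<Sum>t\<in>carrier R. S t)"
    by (simp only: sum_distrib_left)
  also have "(\<Sum>t\<in>carrier R. S t) = q\<^sup>2 * n"
    unfolding S_def sum_cmod_F[symmetric] by (rule sum.group) auto
  also have "q * (q * sqrt (3 * n ^ 3) * (q\<^sup>2 * n)) = q\<^sup>2 * (q\<^sup>2 * n * sqrt (3 * n ^ 3))"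
    by (simp add: power2_eq_square mult_ac)
  finally show ?thesis using q_pos by (subst (asm) mult_le_cancel_left_pos) auto
qed

text \<open>The square of \<nu> s is a character sum over two pairs of points, with phase s times
  the sum of the two distances. \<open>parseval_card\<close> over s counts the coincidences of such
  sums.\<close>

lemma energy: "(\<Sum>s\<in>carrier R. cmod (\<nu> s) ^ 4) = q * real (dist_energy R E)"
proof -
  let ?A = "(E \<times> E) \<times> (E \<times> E)"
  let ?d = "\<lambda>p. sq_dist R (fst p) (snd p)"
  let ?f = "\<lambda>a. ?d (fst a) \<oplus> ?d (snd a)"
  have f: "?f a \<in> carrier R" if "a \<in> ?A" for a using that E_V by auto
  have "(\<Sum>s\<in>carrier R. (cmod (\<Sum>a\<in>?A. \<chi> (s \<otimes> ?f a)))\<^sup>2)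
    = q * real (card {p \<in> ?A \<times> ?A. ?f (fst p) = ?f (snd p)})"
    by (rule parseval_card) (simp_all add: orthogonality f)
  moreover have "(cmod (\<Sum>a\<in>?A. \<chi> (s \<otimes> ?f a)))\<^sup>2 = cmod (\<nu> s) ^ 4" if s: "s \<in> carrier R" for s
  proof -
    have \<nu>: "\<nu> s = (\<Sum>p\<in>E \<times> E. \<chi> (s \<otimes> ?d p))"
      unfolding \<nu>_def sum.cartesian_product' by simp
    have "(\<Sum>a\<in>?A. \<chi> (s \<otimes> ?f a)) = (\<Sum>p\<in>E \<times> E. \<Sum>p'\<in>E \<times> E. \<chi> (s \<otimes> ?d p) * \<chi> (s \<otimes> ?d p'))"
      unfolding sum.cartesian_product'[of _ "E \<times> E" "E \<times> E"] fst_conv snd_conv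
      using s E_V by (intro sum.cong refl) (auto simp: r_distr \<chi>_add)
    also have "\<dots> = \<nu> s * \<nu> s" unfolding \<nu> by (simp only: sum_product)
    finally show ?thesis by (simp add: norm_mult power2_eq_square power4_eq_xxxx)
  qed
  \<comment> \<open>Only the bracketing of the tuples differs.\<close>
  moreover have "card {p \<in> ?A \<times> ?A. ?f (fst p) = ?f (snd p)} = dist_energy R E"
    unfolding dist_energy_def
    by (rule bij_betw_same_card[of "\<lambda>((p1, p2), (p3, p4)). (p1, p2, p3, p4)"],
        rule bij_betw_byWitness[where f' = "\<lambda>(p1, p2, p3, p4). ((p1, p2), (p3, p4))"]) auto
  ultimately show ?thesis by simp
qed

text \<open>The frequency 0 gives n^8 / q exactly. For the others, two of the four factors |\<nu> s|
  are bounded by q n and the remaining two are summed by \<open>sum_cmod_\<nu>\<close>.\<close>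

lemma energy_bound:
  "\<bar>real (dist_energy R E) - n ^ 8 / q\<bar> \<le> q ^ 3 * n ^ 3 * sqrt (3 * n ^ 3)"
proof -
  let ?X = "\<Sum>s\<in>carrier R - {\<zero>}. cmod (\<nu> s) ^ 4"
  have "q * real (dist_energy R E) = cmod (\<nu> \<zero>) ^ 4 + ?X"
    using energy by (simp add: sum.remove[of "carrier R" \<zero>])
  also have "cmod (\<nu> \<zero>) ^ 4 = n ^ 8" by (simp add: \<nu>_zero norm_power n_def)
  finally have X: "real (dist_energy R E) - n ^ 8 / q = ?X / q"
    using q_pos by (simp add: field_simps)
  have "?X \<le> (\<Sum>s\<in>carrier R - {\<zero>}. (q * n)\<^sup>2 * (cmod (\<nu> s))\<^sup>2)"
  proof (intro sum_mono)
    fix s assume "s \<in> carrier R - {\<zero>}"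
    then have "(cmod (\<nu> s))\<^sup>2 \<le> (q * n)\<^sup>2" by (intro power_mono cmod_\<nu>_le) auto
    then have "(cmod (\<nu> s))\<^sup>2 * (cmod (\<nu> s))\<^sup>2 \<le> (q * n)\<^sup>2 * (cmod (\<nu> s))\<^sup>2"
      by (rule mult_right_mono) simp
    then show "cmod (\<nu> s) ^ 4 \<le> (q * n)\<^sup>2 * (cmod (\<nu> s))\<^sup>2"
      by (simp add: power4_eq_xxxx power2_eq_square mult_ac)
  qed
  also have "\<dots> \<le> (q * n)\<^sup>2 * (q\<^sup>2 * n * sqrt (3 * n ^ 3))"
    unfolding sum_distrib_left[symmetric] by (intro mult_left_mono sum_cmod_\<nu>) simp
  also have "\<dots> = q * (q ^ 3 * n ^ 3 * sqrt (3 * n ^ 3))"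
    by (simp add: power2_eq_square power3_eq_cube mult_ac)
  finally have "?X / q \<le> q ^ 3 * n ^ 3 * sqrt (3 * n ^ 3)"
    using q_pos by (simp add: divide_le_eq mult_ac)
  \<comment> \<open>The error is nonnegative, so the upper bound controls its absolute
    value.\<close>
  moreover have "?X / q \<ge> 0" using q_pos by (simp add: sum_nonneg)
  ultimately show ?thesis unfolding X by simp
qed

end

section \<open>Constants and the exponent 9/2\<close>

theorem corollary1p7:
  fixes c :: real
  assumes "c > 0"
  shows "\<exists>C > 0. \<exists>q0 :: nat. \<forall>q \<ge> q0. primepow q \<and> [q = 3] (mod 4) \<longrightarrow>
    (\<forall>R :: 'a ring. \<forall>E. field R \<and> finite (carrier R) \<and> card (carrier R) = q \<and>
        E \<subseteq> carrier R \<times> carrier R \<and> real (card E) \<ge> c * real q \<longrightarrow>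
      \<bar>real (dist_energy R E) - real (card E) ^ 8 / real q\<bar>
        \<le> C * real q ^ 3 * real (card E) powr (9 / 2))"
\<comment> \<open>The constant sqrt 3 comes from the three families of solutions in
  \<open>circle_energy\<close>. The estimate is proved for each order separately, with threshold
  0.\<close>
proof (intro exI[of _ "sqrt 3"] conjI exI[of _ "0::nat"] allI impI)
  show "sqrt 3 > 0" by simp
next
  fix q :: nat and R :: "'a ring" and E :: "('a \<times> 'a) set"
  assume q: "primepow q \<and> [q = 3] (mod 4)"
    and RE: "field R \<and> finite (carrier R) \<and> card (carrier R) = q \<and>
        E \<subseteq> carrier R \<times> carrier R \<and> real (card E) \<ge> c * real q"
  interpret field R using RE by simp
  have "carrier R \<noteq> {\<zero>\<^bsub>R\<^esub>}" using one_closed one_not_zero by blast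
  then have "finite (carrier (add_monoid R))" "carrier (add_monoid R) \<noteq> {\<one>\<^bsub>add_monoid R\<^esub>}"
    using RE by simp_all
  \<comment> \<open>A nontrivial character of the additive group of the field.\<close>
  then obtain \<chi> :: "'a \<Rightarrow> complex" and a0 where \<chi>:
    "\<And>a b. a \<in> carrier (add_monoid R) \<Longrightarrow> b \<in> carrier (add_monoid R)
      \<Longrightarrow> \<chi> (a \<otimes>\<^bsub>add_monoid R\<^esub> b) = \<chi> a * \<chi> b"
    "\<And>a. cmod (\<chi> a) = 1" "a0 \<in> carrier (add_monoid R)" "\<chi> a0 \<noteq> 1"
    by (rule comm_group.nontrivial_character_exists[OF a_comm_group]) (rule that)
  note \<chi> = \<chi>[simplified]
  interpret field_character_set R \<chi> a0 E
    by unfold_locales (use RE q \<chi> in \<open>auto simp: cong_def\<close>)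
  define N where "N = real (card E)"
  have bound: "\<bar>real (dist_energy R E) - N ^ 8 / real q\<bar> \<le> real q ^ 3 * N ^ 3 * sqrt (3 * N ^ 3)"
    using energy_bound RE unfolding n_def q_def N_def by simp
  \<comment> \<open>The exponents are 3 + 3/2 = 9/2. The identity powr_realpow between
    \<open>powr\<close> and \<open>^\<close> is used for a positive base; at 0 both sides
    vanish.\<close>
  have "N ^ 3 * sqrt (3 * N ^ 3) = sqrt 3 * N powr (9 / 2)"
  proof (cases "N = 0")
    case False
    moreover have "N \<ge> 0" by (simp add: N_def)
    ultimately have "N > 0" by simp
    have "N powr (9 / 2) = N powr (real 4 + 1 / 2)" by simp
    also have "\<dots> = N powr real 4 * N powr (1 / 2)" by (rule powr_add)
    also have "\<dots> = N ^ 4 * sqrt N"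
      using \<open>N > 0\<close> by (simp only: powr_realpow powr_half_sqrt less_imp_le)
    finally have "N powr (9 / 2) = N ^ 4 * sqrt N" .
    moreover have "sqrt (3 * N ^ 3) = sqrt 3 * (N * sqrt N)"
      using \<open>N > 0\<close> by (simp add: real_sqrt_mult power3_eq_cube)
    ultimately show ?thesis by (simp add: power3_eq_cube power4_eq_xxxx)
  qed simp
  then have eq: "real q ^ 3 * N ^ 3 * sqrt (3 * N ^ 3) = sqrt 3 * real q ^ 3 * N powr (9 / 2)"
    by (simp add: mult_ac)
  then show "\<bar>real (dist_energy R E) - real (card E) ^ 8 / real q\<bar>
        \<le> sqrt 3 * real q ^ 3 * real (card E) powr (9 / 2)"
    using bound unfolding eq by (simp only: N_def)
qed

end
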